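(* Consider the causal adversarial multi-path network model described in the context, with $C$ unit-capacity links, overwrite jamming, no feedback, and with both reliability and perfect secrecy required. For any $\vec z=(z_{rw},z_{ro},z_{wo})$ with $z_{rw}+z_{ro}+z_{wo}\le C$, the maximum achievable reliable and secret rate is $$R^{ow}_{j,s}(\vec z)=\begin{cases} \max\{0,\ C-(z_{wo}+z_{ro}+2z_{rw})\} & \text{if } 2z_{wo}+2z_{rw}<C,\\ 0 & \text{otherwise.}\end{cases}$$
   Context: Model. A sender (Alice) communicates with a receiver (Bob) over $C$ parallel directed noiseless links $L_1,\dots,L_C$, each of unit capacity (over $n$ time slots each link carries a length-$n$ word; large-alphabet regime). A code of block length $n$ and rate $R$ has message $M$ uniform on $\{0,1\}^{nR}$; the encoder is stochastic, using private randomness unknown to the adversary, and maps message and randomness to codewords $\vec X_i$ sent on $L_i$; the decoder maps received words $\vec Y_1,\dots,\vec Y_C$ to $\hat M$. No feedback: the encoder's output depends only on the message and Alice's randomness. Adversary. Calvin, who knows the encoder and decoder, selects pairwise disjoint link sets $Z_{rw},Z_{ro},Z_{wo}$ (unknown to Alice and Bob) with $|Z_{rw}|\le z_{rw}$, $|Z_{ro}|\le z_{ro}$, $|Z_{wo}|\le z_{wo}$; he reads the links in $Z_r=Z_{rw}\cup Z_{ro}$ and jams the links in $Z_w=Z_{rw}\cup Z_{wo}$. He is causal: his jamming of the $t$-th symbols may depend only on the first $t$ symbols observed on $Z_r$. Under additive jamming $\vec Y_i=\vec X_i+\vec E_i$ with $\vec E_i$ chosen by Calvin and $\vec E_i=0$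 for $i\notin Z_w$; under overwrite jamming $\vec Y_i=\vec E_i$ for $i\in Z_w$ and $\vec Y_i=\vec X_i$ otherwise. Reliability and secrecy. Rate $R$ is achievable (reliably and secretly) if for every $\varepsilon>0$ and all sufficiently large $n$ there is a code of block length $n$ and rate $R$ such that $\Pr[\hat M\neq M]<\varepsilon$ against every admissible causal adversary and, for every set $Z_r$ of at most $z_{rw}+z_{ro}$ links, the mutual information $I(M;X_{Z_r})=0$, where $X_{Z_r}$ is the collection of codewords sent on the links in $Z_r$. The maximum achievable rate is the supremum of such $R$. *)

theory Defs
  imports "HOL-Probability.Probability"
begin

text \<open>Links are indexed by 0..<C. Over n time slots each link carries a word of
  length n over the q-ary alphabet {0..<q}; rates are measured in q-ary symbols
  per time slot (unit capacity per link).  A tuple of link words is a function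
  nat => nat list (value [] outside the links).\<close>

definition valid_word :: "nat \<Rightarrow> nat \<Rightarrow> nat list \<Rightarrow> bool" where
  "valid_word q n w \<longleftrightarrow> length w = n \<and> (\<forall>a\<in>set w. a < q)"

definition codeword_tuple :: "nat \<Rightarrow> nat \<Rightarrow> nat \<Rightarrow> (nat \<Rightarrow> nat list) \<Rightarrow> bool" where
  "codeword_tuple C q n X \<longleftrightarrow> (\<forall>i<C. valid_word q n (X i)) \<and> (\<forall>i\<ge>C. X i = [])"

text \<open>Stochastic encoder: for each message m < K a distribution of the transmitted
  codeword tuple (message plus Alice's private randomness); no feedback.\<close>
definition is_encoder :: "nat \<Rightarrow> nat \<Rightarrow> nat \<Rightarrow> nat \<Rightarrow> (nat \<Rightarrow> (nat \<Rightarrow> nat list) pmf) \<Rightarrow> bool" where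
  "is_encoder C q n K enc \<longleftrightarrow> (\<forall>m<K. \<forall>X\<in>set_pmf (enc m). codeword_tuple C q n X)"

definition num_messages :: "nat \<Rightarrow> nat \<Rightarrow> real \<Rightarrow> nat" where
  "num_messages q n R = nat \<lceil>real q powr (real n * R)\<rceil>"

definition admissible_sets ::
  "nat \<Rightarrow> nat \<times> nat \<times> nat \<Rightarrow> nat set \<Rightarrow> nat set \<Rightarrow> nat set \<Rightarrow> bool" where
  "admissible_sets C z Zrw Zro Zwo \<longleftrightarrow>
     (case z of (zrw, zro, zwo) \<Rightarrow>
       Zrw \<subseteq> {..<C} \<and> Zro \<subseteq> {..<C} \<and> Zwo \<subseteq> {..<C} \<and>
       Zrw \<inter> Zro = {} \<and> Zrw \<inter> Zwo = {} \<and> Zro \<inter> Zwo = {} \<and>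
       card Zrw \<le> zrw \<and> card Zro \<le> zro \<and> card Zwo \<le> zwo)"

text \<open>What Calvin has observed up to and including time slot t (0-indexed):
  the first t+1 symbols on every read link.\<close>
definition observation :: "nat set \<Rightarrow> (nat \<Rightarrow> nat list) \<Rightarrow> nat \<Rightarrow> nat \<Rightarrow> nat list" where
  "observation Zr X t = (\<lambda>j. if j \<in> Zr then take (Suc t) (X j) else [])"

text \<open>Causal overwrite jamming.  Calvin's (randomised) strategy: a seed s drawn
  from his own randomness, and a jamming function J s i t obs giving the t-th
  symbol placed on link i, depending only on the observation up to time t.
  Jamming symbols are reduced into the alphabet.\<close>
definition received_ow ::
  "nat \<Rightarrow> nat \<Rightarrow> nat set \<Rightarrow> nat set \<Rightarrow> (nat \<Rightarrow> nat \<Rightarrow> nat \<Rightarrow> (nat \<Rightarrow> nat list) \<Rightarrow> nat) \<Rightarrow> nat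
     \<Rightarrow> (nat \<Rightarrow> nat list) \<Rightarrow> (nat \<Rightarrow> nat list)" where
  "received_ow q n Zr Zw J s X =
     (\<lambda>i. if i \<in> Zw then map (\<lambda>t. J s i t (observation Zr X t) mod q) [0..<n] else X i)"

definition error_prob ::
  "nat \<Rightarrow> nat \<Rightarrow> nat \<Rightarrow> (nat \<Rightarrow> (nat \<Rightarrow> nat list) pmf) \<Rightarrow> ((nat \<Rightarrow> nat list) \<Rightarrow> nat)
     \<Rightarrow> nat set \<Rightarrow> nat set \<Rightarrow> nat set \<Rightarrow> nat pmf
     \<Rightarrow> (nat \<Rightarrow> nat \<Rightarrow> nat \<Rightarrow> (nat \<Rightarrow> nat list) \<Rightarrow> nat) \<Rightarrow> real" where
  "error_prob q n K enc dec Zrw Zro Zwo S J =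
     measure_pmf.prob
       (do { m \<leftarrow> pmf_of_set {..<K}; X \<leftarrow> enc m; s \<leftarrow> S;
             return_pmf (dec (received_ow q n (Zrw \<union> Zro) (Zrw \<union> Zwo) J s X) \<noteq> m) })
       {True}"

text \<open>Mutual information (in bits) between the two components of a discrete joint
  distribution p (all distributions involved here have finite support).\<close>
definition mutual_info :: "('a \<times> 'b) pmf \<Rightarrow> real" where
  "mutual_info p = (\<Sum>(a, b)\<in>set_pmf p.
      pmf p (a, b) * log 2 (pmf p (a, b) / (pmf (map_pmf fst p) a * pmf (map_pmf snd p) b)))"

definition msg_obs_dist :: "nat \<Rightarrow> (nat \<Rightarrow> (nat \<Rightarrow> nat list) pmf) \<Rightarrow> nat set
     \<Rightarrow> (nat \<times> (nat \<Rightarrow> nat list)) pmf" where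
  "msg_obs_dist K enc Z =
     do { m \<leftarrow> pmf_of_set {..<K}; X \<leftarrow> enc m;
          return_pmf (m, (\<lambda>i. if i \<in> Z then X i else [])) }"

definition achievable_ow_secret :: "nat \<Rightarrow> nat \<times> nat \<times> nat \<Rightarrow> real \<Rightarrow> bool" where
  "achievable_ow_secret C z R \<longleftrightarrow> R \<ge> 0 \<and>
     (\<forall>\<epsilon>>0. \<exists>N. \<forall>n\<ge>N. \<exists>q\<ge>2. \<exists>enc dec.
        is_encoder C q n (num_messages q n R) enc \<and>
        (\<forall>Z. Z \<subseteq> {..<C} \<and> card Z \<le> fst z + fst (snd z) \<longrightarrow>
             mutual_info (msg_obs_dist (num_messages q n R) enc Z) = 0) \<and>
        (\<forall>Zrw Zro Zwo S J. admissible_sets C z Zrw Zro Zwo \<longrightarrow>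
             error_prob q n (num_messages q n R) enc dec Zrw Zro Zwo S J < \<epsilon>))"

definition capacity_ow_secret :: "nat \<Rightarrow> nat \<times> nat \<times> nat \<Rightarrow> real" where
  "capacity_ow_secret C z = Sup {R. achievable_ow_secret C z R}"

end

theory Submission
  imports Defs "HOL-Algebra.Algebraic_Closure_Type" "HOL-Library.Z2"
begin

text \<open>Write \<open>zw = zrw + zwo\<close> and \<open>zr = zrw + zro\<close>.

  Upper bounds.  If Calvin overwrites \<open>zw\<close> links with zeros, the receiver only sees the other
  \<open>C - zw\<close> links.  Perfect secrecy keeps the message uniform given \<open>zr\<close> of them, so the decoder
  has to pick it out from the words on the remaining \<open>C - zw - zr\<close> links, and it is right with
  probability at most the number of those words divided by the number of messages.  If moreover
  \<open>C \<le> 2 * zw\<close>, Calvin can replace half of the links by an independently drawn codeword, and the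
  receiver cannot tell which of the two halves is genuine.

  Achievability.  The message is shared by a ramp version of Shamir's scheme, which tolerates
  \<open>zw\<close> erasures and hides the message from \<open>zr\<close> links.  To turn jamming into erasures, the sender
  appends, identically on every link, a random field element \<open>r\<close> and the values at \<open>r\<close> of the
  polynomials whose coefficients are the words sent so far on the links; as \<open>2 * zw < C\<close>, the
  receiver recovers these by majority.  A causal Calvin has fixed his tampering before he
  sees \<open>r\<close>, so over a large field every tampered word is detected with high probability.  The
  hashes leak nothing because each word starts with a uniformly random symbol.\<close>

hide_const (open) up_ring.coeff up_ring.monom Polynomials.degree module.smult

section \<open>Finite fields and interpolation\<close>

locale finite_subfield =
  fixes F :: "'f::field set"
  assumes finite_F: "finite F"
    and zero_F: "0 \<in> F"
    and one_F: "1 \<in> F"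
    and add_F: "x \<in> F \<Longrightarrow> y \<in> F \<Longrightarrow> x + y \<in> F"
    and mult_F: "x \<in> F \<Longrightarrow> y \<in> F \<Longrightarrow> x * y \<in> F"
    and uminus_F: "x \<in> F \<Longrightarrow> - x \<in> F"
    and inverse_F: "x \<in> F \<Longrightarrow> inverse x \<in> F"
begin

lemma diff_F: "x \<in> F \<Longrightarrow> y \<in> F \<Longrightarrow> x - y \<in> F"
  using add_F[of x "- y"] uminus_F by simp

lemma divide_F: "x \<in> F \<Longrightarrow> y \<in> F \<Longrightarrow> x / y \<in> F"
  by (simp add: divide_inverse inverse_F mult_F)

lemma power_F: "x \<in> F \<Longrightarrow> x ^ n \<in> F"
  by (induction n) (auto intro: one_F mult_F)

lemma sum_F: "(\<And>i. i \<in> I \<Longrightarrow> g i \<in> F) \<Longrightarrow> sum g I \<in> F"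
  by (induction I rule: infinite_finite_induct) (auto intro: zero_F add_F)

lemma poly_F: "(\<And>i. coeff p i \<in> F) \<Longrightarrow> x \<in> F \<Longrightarrow> poly p x \<in> F"
  by (auto simp: poly_altdef intro!: sum_F mult_F power_F)

lemma coeff_mult_F:
  "(\<And>i. coeff p i \<in> F) \<Longrightarrow> (\<And>i. coeff q i \<in> F) \<Longrightarrow> coeff (p * q) i \<in> F"
  by (auto simp: coeff_mult intro!: sum_F mult_F)

lemma coeff_prod_F:
  "(\<And>i j. i \<in> I \<Longrightarrow> coeff (p i) j \<in> F) \<Longrightarrow> coeff (prod p I) j \<in> F"
  by (induction I arbitrary: j rule: infinite_finite_induct)
     (auto simp: zero_F one_F intro!: coeff_mult_F)

text \<open>Bounding the coefficient index instead of \<open>degree\<close> makes this a vector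
  space over \<open>F\<close> for every \<open>d\<close>, with \<open>polys 0 = {0}\<close>. The
  coefficients are confined explicitly because the ambient type is a larger field.\<close>

definition polys :: "nat \<Rightarrow> 'f poly set" where
  "polys d = {p. (\<forall>i. coeff p i \<in> F) \<and> (\<forall>i\<ge>d. coeff p i = 0)}"

lemma zero_polys: "0 \<in> polys d"
  by (simp add: polys_def zero_F)

lemma add_polys: "p \<in> polys d \<Longrightarrow> q \<in> polys d \<Longrightarrow> p + q \<in> polys d"
  by (simp add: polys_def add_F)

lemma diff_polys: "p \<in> polys d \<Longrightarrow> q \<in> polys d \<Longrightarrow> p - q \<in> polys d"
  by (simp add: polys_def diff_F)

lemma poly_polys_F: "p \<in> polys d \<Longrightarrow> x \<in> F \<Longrightarrow> poly p x \<in> F"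
  by (simp add: polys_def poly_F)

lemma finite_polys: "finite (polys d)"
proof (rule finite_subset)
  show "polys d \<subseteq> Poly ` {xs. set xs \<subseteq> F \<and> length xs = d}"
  proof
    fix p assume p: "p \<in> polys d"
    have "p = Poly (map (coeff p) [0..<d])"
      using p by (intro poly_eqI) (auto simp: polys_def nth_default_def)
    moreover have "map (coeff p) [0..<d] \<in> {xs. set xs \<subseteq> F \<and> length xs = d}"
      using p by (auto simp: polys_def)
    ultimately show "p \<in> Poly ` {xs. set xs \<subseteq> F \<and> length xs = d}"
      by blast
  qed
qed (use finite_F in \<open>simp add: finite_lists_length_eq\<close>)

text \<open>The difference would be a nonzero polynomial of degree below \<open>d\<close> with at
  least \<open>d\<close> roots. In decoding, this is how enough untampered links determine a sharing
  polynomial.\<close>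

lemma polys_eqI:
  assumes "p \<in> polys d" "q \<in> polys d" "A \<subseteq> F" "d \<le> card A"
    and "\<And>x. x \<in> A \<Longrightarrow> poly p x = poly q x"
  shows "p = q"
proof (rule ccontr)
  assume "p \<noteq> q"
  then have nz: "p - q \<noteq> 0" by simp
  have "coeff (p - q) i = 0" if "i \<ge> d" for i
    using assms(1,2) that by (simp add: polys_def)
  then have "degree (p - q) < d"
    using nz by (metis leading_coeff_0_iff not_le)
  moreover have "card A \<le> card {x. poly (p - q) x = 0}"
    using assms(5) nz by (intro card_mono poly_roots_finite) auto
  ultimately show False
    using card_poly_roots_bound[OF nz] assms(4) by linarith
qed

text \<open>Newton's scheme: a new node is handled by adding a multiple of the product
  \<open>w\<close> that vanishes at all earlier nodes. Only operations of \<open>F\<close> occur, so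
  the coefficients stay in \<open>F\<close>.\<close>

lemma interpolation:
  assumes "finite I" "inj_on a I" "a ` I \<subseteq> F" "\<And>i. i \<in> I \<Longrightarrow> y i \<in> F"
  shows "\<exists>p \<in> polys (card I). \<forall>i\<in>I. poly p (a i) = y i"
  using assms
proof (induction I rule: finite_induct)
  case empty
  then show ?case using zero_polys by auto
next
  case (insert j I)
  then obtain p where p: "p \<in> polys (card I)" "\<forall>i\<in>I. poly p (a i) = y i"
    by (auto simp: inj_on_insert)
  define w where "w = (\<Prod>i\<in>I. [:- a i, 1:])"
  define c where "c = (y j - poly p (a j)) / poly w (a j)"
  have w_F: "coeff w i \<in> F" for i
    unfolding w_def using insert.prems
    by (intro coeff_prod_F) (auto simp: coeff_pCons uminus_F zero_F one_F split: nat.splits)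
  have deg_w: "degree w = card I"
    unfolding w_def by (subst degree_prod_eq_sum_degree) auto
  have w_nz: "poly w (a j) \<noteq> 0"
    using insert.prems(1) insert.hyps by (auto simp: w_def poly_prod inj_on_def)
  have c_F: "c \<in> F"
    unfolding c_def using insert.prems p(1) w_F
    by (intro divide_F diff_F poly_F[of w] poly_polys_F[of p]) auto
  have "p + smult c w \<in> polys (card (insert j I))"
    using p(1) w_F c_F deg_w insert.hyps
    by (auto simp: polys_def coeff_eq_0 intro!: add_F mult_F)
  moreover have "poly (p + smult c w) (a i) = y i" if "i \<in> insert j I" for i
  proof (cases "i = j")
    case True
    then show ?thesis using w_nz by (simp add: c_def)
  next
    case False
    with that have "i \<in> I" by simp
    then have "poly w (a i) = 0"
      using insert.hyps by (auto simp: w_def poly_prod intro!: prod_zero)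
    then show ?thesis using p(2) \<open>i \<in> I\<close> by simp
  qed
  ultimately show ?case by blast
qed

lemma polys_mono: "d \<le> e \<Longrightarrow> polys d \<subseteq> polys e"
  by (auto simp: polys_def)

end

lemma CHAR_bit: "CHAR(bit) = 2"
  by (rule CHAR_eq_posI) (auto simp: less_Suc_eq numeral_2_eq_2)

text \<open>The alphabet size varies with the block length, so the field cannot be a type.  All fields
  of order a power of two live inside the single type of the algebraic closure of the
  two-element field.\<close>

lemma ex_finite_subfield:
  assumes "m > 0"
  shows "\<exists>F :: bit alg_closure set. finite_subfield F \<and> card F = 2 ^ m"
proof -
  define q :: nat where "q = 2 ^ m"
  have q2: "q \<ge> 2" using assms unfolding q_def by (cases m) auto
  have q0: "of_nat q = (0 :: bit alg_closure)"
    using assms unfolding q_def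
    by (simp only: of_nat_eq_0_iff_char_dvd CHAR_alg_closure CHAR_bit) simp
  have neg: "- x = x" for x :: "bit alg_closure"
  proof -
    have "x + x = of_nat 2 * x" by simp
    also have "of_nat 2 = (0 :: bit alg_closure)"
      by (simp only: of_nat_eq_0_iff_char_dvd CHAR_alg_closure CHAR_bit dvd_refl)
    finally show ?thesis by (simp add: minus_unique)
  qed
  \<comment> \<open>The field of order \<open>q\<close> consists of the roots of x^q - x. This
    polynomial splits, so it remains to see that its \<open>q\<close> roots are distinct.\<close>
  define F where "F = {x :: bit alg_closure. x ^ q = x}"
  define p :: "bit alg_closure poly" where "p = monom 1 q - monom 1 1"
  have poly_p: "poly p x = x ^ q - x" for x
    by (simp add: p_def poly_monom)
  have "coeff p q = 1" using q2 by (simp add: p_def)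
  then have p_nz: "p \<noteq> 0" by auto
  have "degree p \<le> q" unfolding p_def using q2
    by (intro degree_diff_le order.trans[OF degree_monom_le]) auto
  then have deg_p: "degree p = q"
    using \<open>coeff p q = 1\<close> by (metis le_degree one_neq_zero order_antisym)
  have pderiv_p: "pderiv p = - 1"
    using q0 by (simp add: p_def pderiv_diff pderiv_monom monom_0 one_pCons)
  obtain A where A: "size A = q" "p = (\<Prod>x\<in>#A. [:- x, 1:])"
    using alg_closed_imp_factorization[OF p_nz] deg_p \<open>coeff p q = 1\<close> by auto
  \<comment> \<open>A double root would also be a root of the derivative, which is the constant
    -1.\<close>
  have "count A x \<le> 1" for x
  proof (rule ccontr)
    assume "\<not> count A x \<le> 1"
    then have "{#x, x#} \<subseteq># A"
      by (auto simp: subseteq_mset_def)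
    then obtain B where "A = {#x, x#} + B"
      by (metis subset_mset.le_iff_add)
    then have "p = [:- x, 1:] * ([:- x, 1:] * (\<Prod>x\<in>#B. [:- x, 1:]))"
      using A by simp
    then have "poly (pderiv p) x = 0"
      by (simp only: pderiv_mult poly_add poly_mult) simp
    then show False using pderiv_p by simp
  qed
  then have "count A x = (if x \<in># A then 1 else 0)" for x
    by (metis One_nat_def count_eq_zero_iff le_SucE le_zero_eq)
  then have "A = mset_set (set_mset A)"
    by (intro multiset_eqI) (simp add: count_mset_set')
  then have "card (set_mset A) = q"
    using A(1) by (metis size_mset_set)
  moreover have "set_mset A = F"
  proof -
    have "x \<in> F \<longleftrightarrow> poly p x = 0" for x
      by (simp add: F_def poly_p)
    moreover have "poly p x = 0 \<longleftrightarrow> x \<in># A" for x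
      unfolding A(2) by (auto simp: poly_prod_mset prod_mset_zero_iff)
    ultimately show ?thesis by blast
  qed
  ultimately have card: "card F = q" by simp
  \<comment> \<open>Additivity of the iterated Frobenius map gives closure under addition.\<close>
  have add: "(x + y) ^ q = x ^ q + y ^ q" for x y :: "bit alg_closure"
    by (rule freshmans_dream'[where n = m]) (simp_all add: CHAR_bit q_def)
  have "finite_subfield F"
  proof
    show "finite F" using card q2 by (intro card_ge_0_finite) simp
    show "- x \<in> F" if "x \<in> F" for x
      using that by (simp only: neg)
  qed (use q2 in \<open>auto simp: F_def add power_mult_distrib power_inverse\<close>)
  with card show ?thesis unfolding q_def by blast
qed

section \<open>Probability and mutual information\<close>

lemma pmf_bind_le:
  assumes "\<And>x. x \<in> set_pmf p \<Longrightarrow> pmf (f x) y \<le> c"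
  shows "pmf (bind_pmf p f) y \<le> c"
  unfolding pmf_bind
  by (rule measure_pmf.integral_le_const)
     (auto simp: AE_measure_pmf_iff assms pmf_le_1
       intro!: measure_pmf.integrable_const_bound[where B = 1])

lemma pmf_bind_ge:
  assumes "\<And>x. x \<in> set_pmf p \<Longrightarrow> pmf (f x) y \<ge> c"
  shows "pmf (bind_pmf p f) y \<ge> c"
  unfolding pmf_bind
  by (rule measure_pmf.integral_ge_const)
     (auto simp: AE_measure_pmf_iff assms pmf_le_1
       intro!: measure_pmf.integrable_const_bound[where B = 1])

lemma pmf_map_Not: "pmf (map_pmf Not p) True = 1 - pmf p True"
  using pmf_map_inj'[of Not p False] pmf_False_conv_True[of p] by (auto simp: inj_on_def)

lemma mutual_info_pair_pmf: "mutual_info (pair_pmf A B) = 0"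
  unfolding mutual_info_def
  by (rule sum.neutral) (auto simp: pmf_pair map_fst_pair_pmf map_snd_pair_pmf set_pmf_iff)

text \<open>The proof is the equality case of Gibbs' inequality.\<close>

lemma mutual_info_zero_imp_le:
  assumes fin: "finite (set_pmf p)" and zero: "mutual_info p = 0"
  shows "pmf p (a, b) \<le> pmf (map_pmf fst p) a * pmf (map_pmf snd p) b"
proof (cases "(a, b) \<in> set_pmf p")
  case False
  then show ?thesis by (simp add: set_pmf_iff)
next
  case True
  define u where "u x = pmf (pair_pmf (map_pmf fst p) (map_pmf snd p)) x" for x
  have u_eq: "u (a, b) = pmf (map_pmf fst p) a * pmf (map_pmf snd p) b" for a b
    by (simp add: u_def pmf_pair)
  \<comment> \<open>Subtracting the linear term makes each summand nonnegative by ln t <= t - 1. As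
    \<open>u\<close> has total mass at most 1 and the mutual information is zero, the summands add
    up to at most 0, so all vanish and \<open>u\<close> equals \<open>pmf p\<close> on the
    support.\<close>
  define g where "g x = pmf p x * ln (pmf p x / u x) - (pmf p x - u x)" for x
  have p_pos: "pmf p x > 0" if "x \<in> set_pmf p" for x
    using that by (simp add: pmf_positive)
  have u_pos: "u x > 0" if "x \<in> set_pmf p" for x
    unfolding u_def using that by (intro pmf_positive) (auto simp: mem_Times_iff)
  have g_eq: "g x = pmf p x * ((u x / pmf p x - 1) - ln (u x / pmf p x))"
    if "x \<in> set_pmf p" for x
    using p_pos[OF that] u_pos[OF that] by (simp add: g_def ln_div field_simps)
  have g_nonneg: "g x \<ge> 0" if "x \<in> set_pmf p" for x
    using g_eq[OF that] p_pos[OF that] u_pos[OF that] ln_le_minus_one[of "u x / pmf p x"] by simp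
  have "(\<Sum>x\<in>set_pmf p. pmf p x * ln (pmf p x / u x)) = ln 2 * mutual_info p"
    unfolding mutual_info_def sum_distrib_left
    by (intro sum.cong) (auto simp: u_eq log_def)
  then have "(\<Sum>x\<in>set_pmf p. g x) = (\<Sum>x\<in>set_pmf p. u x) - 1"
    using fin zero by (simp add: g_def sum_subtractf sum_pmf_eq_1)
  also have "\<dots> \<le> 0"
    unfolding u_def measure_measure_pmf_finite[OF fin, symmetric] by simp
  finally have "(\<Sum>x\<in>set_pmf p. g x) = 0"
    using g_nonneg by (meson order_antisym sum_nonneg)
  then have "g (a, b) = 0"
    using fin g_nonneg True by (simp add: sum_nonneg_eq_0_iff)
  then have "u (a, b) / pmf p (a, b) = 1"
    using g_eq[OF True] p_pos[OF True] u_pos[OF True]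
    by (intro ln_eq_minus_one) auto
  then show ?thesis using p_pos[OF True] u_eq by simp
qed

section \<open>Upper bounds\<close>

lemma valid_words_eq: "{w. valid_word q n w} = {w. set w \<subseteq> {..<q} \<and> length w = n}"
  by (auto simp: valid_word_def)

lemma finite_valid_words: "finite {w. valid_word q n w}"
  unfolding valid_words_eq by (rule finite_lists_length_eq) simp

lemma card_valid_words: "card {w. valid_word q n w} = q ^ n"
  unfolding valid_words_eq by (subst card_lists_length_eq) auto

lemma finite_codeword_tuples: "finite {c. codeword_tuple C q n c}"
proof (rule finite_subset)
  show "{c. codeword_tuple C q n c} \<subseteq>
      (\<lambda>f i. if i < C then f i else []) ` PiE {..<C} (\<lambda>_. {w. valid_word q n w})"
  proof
    fix c assume "c \<in> {c. codeword_tuple C q n c}"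
    then show "c \<in> (\<lambda>f i. if i < C then f i else []) ` PiE {..<C} (\<lambda>_. {w. valid_word q n w})"
      by (intro rev_image_eqI[of "restrict c {..<C}"]) (auto simp: codeword_tuple_def)
  qed
qed (intro finite_imageI finite_PiE finite_lessThan finite_valid_words)

lemma num_messages_ge: "real (num_messages q n R) \<ge> real q powr (real n * R)"
  unfolding num_messages_def by (simp add: real_nat_ceiling_ge)

lemma num_messages_pos: "q \<ge> 2 \<Longrightarrow> num_messages q n R > 0"
  by (simp add: num_messages_def)

lemma num_messages_ge_2:
  assumes "q \<ge> 2" "n > 0" "R > 0"
  shows "num_messages q n R \<ge> 2"
proof -
  have "1 < real q powr (real n * R)"
    using assms powr_less_mono[of 0 "real n * R" "real q"] by simp
  then show ?thesis
    using num_messages_ge[of q n R] by linarith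
qed

text \<open>The attacks of the converse only prescribe which links are jammed; the read-write budget
  is used up first and the rest is write-only.\<close>

lemma ex_jamming_sets:
  assumes "B \<subseteq> {..<C}" "card B \<le> zrw + zwo"
  shows "\<exists>Zrw Zwo. admissible_sets C (zrw, zro, zwo) Zrw {} Zwo \<and> Zrw \<union> Zwo = B"
proof -
  have fin: "finite B" using assms(1) finite_subset by blast
  obtain Zrw where Z: "Zrw \<subseteq> B" "card Zrw = min zrw (card B)"
    using obtain_subset_with_card_n[of "min zrw (card B)" B] by auto
  have "card (B - Zrw) = card B - card Zrw"
    using Z fin finite_subset by (intro card_Diff_subset) auto
  then have "admissible_sets C (zrw, zro, zwo) Zrw {} (B - Zrw)"
    using Z assms by (auto simp: admissible_sets_def)
  then show ?thesis using Z(1) by blast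
qed

text \<open>Both the error probability and the secrecy condition are images of this one law, which
  lets them be combined.\<close>

definition message_codeword_pmf ::
  "nat \<Rightarrow> (nat \<Rightarrow> (nat \<Rightarrow> nat list) pmf) \<Rightarrow> (nat \<times> (nat \<Rightarrow> nat list)) pmf" where
  "message_codeword_pmf K enc = do { m \<leftarrow> pmf_of_set {..<K}; c \<leftarrow> enc m; return_pmf (m, c) }"

lemma set_message_codeword_pmf:
  assumes "is_encoder C q n K enc" "K > 0" "(m, c) \<in> set_pmf (message_codeword_pmf K enc)"
  shows "m < K" "codeword_tuple C q n c"
proof -
  have "{..<K} \<noteq> {}" using assms(2) by auto
  then show "m < K" "codeword_tuple C q n c"
    using assms(1,3) by (auto simp: message_codeword_pmf_def is_encoder_def)
qed

lemma fst_message_codeword_pmf: "map_pmf fst (message_codeword_pmf K enc) = pmf_of_set {..<K}"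
  by (simp add: message_codeword_pmf_def map_bind_pmf map_pmf_const bind_return_pmf')

lemma msg_obs_dist_eq:
  "msg_obs_dist K enc Z =
     map_pmf (\<lambda>(m, c). (m, \<lambda>i. if i \<in> Z then c i else [])) (message_codeword_pmf K enc)"
  by (simp add: msg_obs_dist_def message_codeword_pmf_def map_bind_pmf)

lemma error_prob_eq:
  "error_prob q n K enc dec Zrw Zro Zwo S J =
     pmf (do { (m, c) \<leftarrow> message_codeword_pmf K enc; s \<leftarrow> S;
               return_pmf (dec (received_ow q n (Zrw \<union> Zro) (Zrw \<union> Zwo) J s c) \<noteq> m) }) True"
  by (simp add: error_prob_def message_codeword_pmf_def measure_pmf_single bind_assoc_pmf
      bind_return_pmf)

text \<open>Given the observation on the links in \<open>Z\<close>, the message stays uniform, while the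
  decoder's output can only take as many values as there are words on the links in \<open>U\<close>.\<close>

lemma secret_decoding_bound:
  assumes enc: "is_encoder C q n K enc" and K: "K > 0"
    and part: "V \<union> Z \<union> U = {..<C}" "V \<inter> Z = {}" "V \<inter> U = {}" "Z \<inter> U = {}"
    and secret: "mutual_info (msg_obs_dist K enc Z) = 0"
  shows "measure_pmf.prob (message_codeword_pmf K enc)
           {(m, c). dec (\<lambda>i. if i \<in> V then w else c i) = m} \<le> real ((q ^ n) ^ card U) / real K"
proof -
  let ?P = "message_codeword_pmf K enc"
  define obs where "obs = (\<lambda>c :: nat \<Rightarrow> nat list. \<lambda>i. if i \<in> Z then c i else [])"
  define p where "p = msg_obs_dist K enc Z"
  have p_eq: "p = map_pmf (\<lambda>(m, c). (m, obs c)) ?P"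
    unfolding p_def msg_obs_dist_eq obs_def by simp
  define W where "W = PiE U (\<lambda>_. {w. valid_word q n w})"
  have fin_U: "finite U" using part(1) by (metis finite_Un finite_lessThan)
  have fin_W: "finite W"
    unfolding W_def by (intro finite_PiE fin_U finite_valid_words)
  \<comment> \<open>\<open>G v\<close> collects the decoder outputs compatible with the observation
    \<open>v\<close>: the word \<open>w\<close> on \<open>V\<close> is fixed, \<open>v\<close> fills
    \<open>Z\<close>, and only the words on \<open>U\<close> vary.\<close>
  define G where "G v = (\<lambda>f. dec (\<lambda>i. if i \<in> V then w else if i \<in> Z then v i
      else if i \<in> U then f i else [])) ` W" for v
  have fin_G: "finite (G v)" for v
    unfolding G_def using fin_W by simp
  have "card W = (q ^ n) ^ card U"
    unfolding W_def by (subst card_PiE) (simp_all add: fin_U card_valid_words)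
  then have card_G: "card (G v) \<le> (q ^ n) ^ card U" for v
    unfolding G_def using card_image_le[OF fin_W] by metis
  have dec_G: "dec (\<lambda>i. if i \<in> V then w else c i) \<in> G (obs c)"
    if "codeword_tuple C q n c" for c
  proof -
    have "restrict c U \<in> W"
      using that part(1) by (auto simp: W_def codeword_tuple_def)
    moreover have "(\<lambda>i. if i \<in> V then w else c i) =
        (\<lambda>i. if i \<in> V then w else if i \<in> Z then obs c i else if i \<in> U then restrict c U i else [])"
    proof
      fix i
      have "i \<in> V \<union> Z \<union> U \<or> c i = []"
        using that unfolding part(1) by (cases "i < C") (auto simp: codeword_tuple_def)
      then show "(if i \<in> V then w else c i) = (if i \<in> V then w else if i \<in> Z then obs c i
          else if i \<in> U then restrict c U i else [])"
        by (auto simp: obs_def)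
    qed
    ultimately show ?thesis unfolding G_def by (intro image_eqI[of _ _ "restrict c U"]) auto
  qed
  have "finite ({..<K} \<times> {c. codeword_tuple C q n c})"
    using finite_codeword_tuples by simp
  then have fin_P: "finite (set_pmf ?P)"
    by (rule finite_subset[rotated]) (auto dest: set_message_codeword_pmf[OF enc K])
  then have fin_p: "finite (set_pmf p)" unfolding p_eq by simp
  have fst_p: "map_pmf fst p = pmf_of_set {..<K}"
    unfolding p_eq
    by (simp add: pmf.map_comp o_def case_prod_unfold flip: fst_message_codeword_pmf[of K enc])
  \<comment> \<open>Perfect secrecy bounds the joint law by the product of its marginals, and the
    message marginal is uniform.\<close>
  have p_le: "pmf p (m, v) \<le> pmf (map_pmf snd p) v / K" if "m < K" for m v
  proof -
    have "{..<K} \<noteq> {}" using K by auto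
    then have "pmf (pmf_of_set {..<K}) m = 1 / K"
      using that by (simp add: pmf_of_set)
    then show ?thesis
      using mutual_info_zero_imp_le[OF fin_p, of m v] secret by (simp add: p_def[symmetric] fst_p)
  qed
  define B where "B = snd ` set_pmf p"
  have fin_B: "finite B" unfolding B_def using fin_p by simp
  have "measure_pmf.prob ?P {(m, c). dec (\<lambda>i. if i \<in> V then w else c i) = m}
      \<le> measure_pmf.prob ?P ((\<lambda>(m, c). (m, obs c)) -` (SIGMA m:{..<K}. {v. v \<in> B \<and> m \<in> G v}))"
  proof (rule measure_pmf.finite_measure_mono_AE)
    show "AE x in measure_pmf ?P. x \<in> {(m, c). dec (\<lambda>i. if i \<in> V then w else c i) = m} \<longrightarrow>
        x \<in> (\<lambda>(m, c). (m, obs c)) -` (SIGMA m:{..<K}. {v. v \<in> B \<and> m \<in> G v})"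
    proof (rule AE_pmfI, clarify)
      fix m c assume mem: "(dec (\<lambda>i. if i \<in> V then w else c i), c) \<in> set_pmf ?P"
      then have "obs c \<in> B"
        unfolding B_def p_eq by force
      then show "(dec (\<lambda>i. if i \<in> V then w else c i), c) \<in>
          (\<lambda>(m, c). (m, obs c)) -` (SIGMA m:{..<K}. {v. v \<in> B \<and> m \<in> G v})"
        using set_message_codeword_pmf[OF enc K mem] dec_G by auto
    qed
  qed simp
  also have "\<dots> = measure_pmf.prob p (SIGMA m:{..<K}. {v. v \<in> B \<and> m \<in> G v})"
    unfolding p_eq by simp
  also have "\<dots> = (\<Sum>(m, v)\<in>(SIGMA m:{..<K}. {v. v \<in> B \<and> m \<in> G v}). pmf p (m, v))"
    by (subst measure_measure_pmf_finite) (auto intro!: finite_SigmaI finite_subset[OF _ fin_B])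
  \<comment> \<open>Grouping by observation: each \<open>v\<close> admits at most
    \<open>card (G v)\<close> correctly decoded messages, each of conditional probability at most 1
    / \<open>K\<close>.\<close>
  also have "\<dots> = (\<Sum>(v, m)\<in>(SIGMA v:B. {..<K} \<inter> G v). pmf p (m, v))"
    by (rule sum.reindex_bij_witness[of _ prod.swap prod.swap]) auto
  also have "\<dots> = (\<Sum>v\<in>B. \<Sum>m\<in>{..<K} \<inter> G v. pmf p (m, v))"
    using fin_B by (subst sum.Sigma) auto
  also have "\<dots> \<le> (\<Sum>v\<in>B. real ((q ^ n) ^ card U) * (pmf (map_pmf snd p) v / K))"
  proof (rule sum_mono)
    fix v assume "v \<in> B"
    have "(\<Sum>m\<in>{..<K} \<inter> G v. pmf p (m, v)) \<le> (\<Sum>m\<in>{..<K} \<inter> G v. pmf (map_pmf snd p) v / K)"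
      by (intro sum_mono p_le) auto
    also have "\<dots> = real (card ({..<K} \<inter> G v)) * (pmf (map_pmf snd p) v / K)"
      by simp
    also have "\<dots> \<le> real ((q ^ n) ^ card U) * (pmf (map_pmf snd p) v / K)"
      using card_G[of v] card_mono[OF fin_G, of "{..<K} \<inter> G v" v]
      by (intro mult_right_mono) (auto simp del: of_nat_power)
    finally show "(\<Sum>m\<in>{..<K} \<inter> G v. pmf p (m, v))
        \<le> real ((q ^ n) ^ card U) * (pmf (map_pmf snd p) v / K)" .
  qed
  also have "\<dots> = real ((q ^ n) ^ card U) / K * (\<Sum>v\<in>B. pmf (map_pmf snd p) v)"
    by (simp add: sum_distrib_left)
  also have "\<dots> = real ((q ^ n) ^ card U) / K"
    unfolding B_def using fin_p by (subst sum_pmf_eq_1) auto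
  finally show ?thesis .
qed

section \<open>Codes at a fixed block length and the two converse bounds\<close>

definition secret_code :: "nat \<Rightarrow> nat \<times> nat \<times> nat \<Rightarrow> nat \<Rightarrow> nat \<Rightarrow> nat \<Rightarrow> real \<Rightarrow>
    (nat \<Rightarrow> (nat \<Rightarrow> nat list) pmf) \<Rightarrow> ((nat \<Rightarrow> nat list) \<Rightarrow> nat) \<Rightarrow> bool" where
  "secret_code C z q n K \<epsilon> enc dec \<longleftrightarrow>
     is_encoder C q n K enc \<and>
     (\<forall>Z. Z \<subseteq> {..<C} \<and> card Z \<le> fst z + fst (snd z) \<longrightarrow> mutual_info (msg_obs_dist K enc Z) = 0) \<and>
     (\<forall>Zrw Zro Zwo S J. admissible_sets C z Zrw Zro Zwo \<longrightarrow>
        error_prob q n K enc dec Zrw Zro Zwo S J < \<epsilon>)"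

lemma achievable_ow_secret_iff:
  "achievable_ow_secret C z R \<longleftrightarrow> R \<ge> 0 \<and>
     (\<forall>\<epsilon>>0. \<exists>N. \<forall>n\<ge>N. \<exists>q\<ge>2. \<exists>enc dec. secret_code C z q n (num_messages q n R) \<epsilon> enc dec)"
  unfolding achievable_ow_secret_def secret_code_def ..

lemma achievable_obtain_code:
  assumes "achievable_ow_secret C z R" "\<epsilon> > 0"
  obtains q n enc dec where "n \<ge> n0" "q \<ge> 2" "secret_code C z q n (num_messages q n R) \<epsilon> enc dec"
proof -
  obtain N where "\<forall>n\<ge>N. \<exists>q\<ge>2. \<exists>enc dec. secret_code C z q n (num_messages q n R) \<epsilon> enc dec"
    using assms unfolding achievable_ow_secret_iff by blast
  then have "\<exists>q\<ge>2. \<exists>enc dec. secret_code C z q (max n0 N) (num_messages q (max n0 N) R) \<epsilon> enc dec"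
    by simp
  then show thesis using that[of "max n0 N"] by auto
qed

lemma achievable_le:
  assumes "zrw + zro + zwo \<le> C" and ach: "achievable_ow_secret C (zrw, zro, zwo) R"
  shows "R \<le> max 0 (real C - (real zwo + real zro + 2 * real zrw))"
proof (rule ccontr)
  assume that: "\<not> R \<le> max 0 (real C - (real zwo + real zro + 2 * real zrw))"
  \<comment> \<open>Truncated subtraction makes \<open>k\<close> equal to the claimed bound,
    including its maximum with 0.\<close>
  define k where "k = C - (zrw + zwo) - (zrw + zro)"
  have "R > real k" using that unfolding k_def by linarith
  \<comment> \<open>The block length is chosen with n * (R - k) >= 1, so the guessing bound q^(n *
    k) / \<open>K\<close> falls to 1 / q <= 1 / 2, while reliability demands success probability
    above 1 / 2.\<close>
  obtain q n enc dec where n: "n \<ge> nat \<lceil>1 / (R - k)\<rceil>" and q: "q \<ge> 2"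
    and code: "secret_code C (zrw, zro, zwo) q n (num_messages q n R) (1 / 2) enc dec"
    by (rule achievable_obtain_code[OF ach, of "1 / 2" "nat \<lceil>1 / (R - k)\<rceil>"]) auto
  define K where "K = num_messages q n R"
  have K: "K > 0" unfolding K_def using q by (rule num_messages_pos)
  have enc: "is_encoder C q n K enc"
    and secret: "\<And>Z. Z \<subseteq> {..<C} \<Longrightarrow> card Z \<le> zrw + zro \<Longrightarrow> mutual_info (msg_obs_dist K enc Z) = 0"
    and err: "\<And>Zrw Zro Zwo S J. admissible_sets C (zrw, zro, zwo) Zrw Zro Zwo \<Longrightarrow>
        error_prob q n K enc dec Zrw Zro Zwo S J < 1 / 2"
    using code unfolding secret_code_def K_def by auto
  \<comment> \<open>The links split into jammed, observed and remaining ones. The \<open>min\<close>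
    covers the case where the first two budgets together exceed \<open>C\<close>; then
    \<open>U\<close> is empty.\<close>
  define V where "V = {..<zrw + zwo}"
  define Z where "Z = {zrw + zwo..<min C (zrw + zwo + (zrw + zro))}"
  define U where "U = {min C (zrw + zwo + (zrw + zro))..<C}"
  have part: "V \<union> Z \<union> U = {..<C}" "V \<inter> Z = {}" "V \<inter> U = {}" "Z \<inter> U = {}"
    unfolding V_def Z_def U_def using assms(1) by auto
  have card_U: "card U = k" unfolding U_def k_def by auto
  have Z_secret: "mutual_info (msg_obs_dist K enc Z) = 0"
    by (rule secret) (auto simp: Z_def)
  obtain Zrw Zwo where adm: "admissible_sets C (zrw, zro, zwo) Zrw {} Zwo" and V: "Zrw \<union> Zwo = V"
    using ex_jamming_sets[of V C zrw zwo zro] assms(1) by (auto simp: V_def)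
  let ?J = "\<lambda>_ _ _ _. 0 :: nat"
  let ?dec = "\<lambda>(m, c). dec (\<lambda>i. if i \<in> V then map (\<lambda>_. 0 mod q) [0..<n] else c i) = m"
  have "1 / 2 < 1 - error_prob q n K enc dec Zrw {} Zwo (return_pmf 0) ?J"
    using err[OF adm, of "return_pmf 0" ?J] by simp
  also have "\<dots> = pmf (map_pmf ?dec (message_codeword_pmf K enc)) True"
    unfolding error_prob_eq pmf_map_Not[symmetric]
    by (simp add: received_ow_def V map_bind_pmf case_prod_unfold bind_return_pmf map_pmf_def[symmetric]
        pmf.map_comp o_def)
  also have "\<dots> = measure_pmf.prob (message_codeword_pmf K enc) {x. ?dec x}"
    by (simp add: pmf_map vimage_def)
  finally have "1 / 2 < measure_pmf.prob (message_codeword_pmf K enc)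
      {(m, c). dec (\<lambda>i. if i \<in> V then map (\<lambda>_. 0 mod q) [0..<n] else c i) = m}" .
  also have "\<dots> \<le> real ((q ^ n) ^ k) / real K"
    using secret_decoding_bound[OF enc K part Z_secret] by (simp add: card_U)
  finally have "1 / 2 < real ((q ^ n) ^ k) / real K" .
  also have "\<dots> \<le> real ((q ^ n) ^ k) / real q powr (real n * R)"
    using num_messages_ge[of q n R] q K unfolding K_def
    by (intro divide_left_mono mult_pos_pos) auto
  also have "\<dots> = real q powr (real n * real k - real n * R)"
    using q by (simp add: powr_diff powr_realpow[symmetric] powr_powr)
  also have "\<dots> \<le> real q powr (- 1)"
  proof -
    have "real n \<ge> 1 / (R - k)" using n by linarith
    then have "real n * (R - k) \<ge> 1"
      using \<open>R > real k\<close> by (simp add: field_simps)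
    then show ?thesis using q by (intro powr_mono) (auto simp: algebra_simps)
  qed
  also have "\<dots> \<le> 1 / 2"
    using q by (simp add: powr_minus field_simps)
  finally show False by simp
qed

text \<open>The first \<open>zrw + zwo\<close> links and their complement are both small enough to
  be jammed. Replacing either part by that of an independent codeword yields, after swapping the two
  codewords, the same received tuple. One decoder output cannot match two different messages, so the
  two error probabilities sum to at least 1 / 2, although each is below 1 / 4.\<close>

lemma achievable_symmetrizable_le:
  assumes C: "zrw + zro + zwo \<le> C" "C \<le> 2 * zwo + 2 * zrw"
    and ach: "achievable_ow_secret C (zrw, zro, zwo) R"
  shows "R \<le> 0"
proof (rule ccontr)
  assume "\<not> R \<le> 0"
  then have R: "R > 0" by simp
  obtain q n enc dec where n: "n \<ge> 1" and q: "q \<ge> 2"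
    and code: "secret_code C (zrw, zro, zwo) q n (num_messages q n R) (1 / 4) enc dec"
    by (rule achievable_obtain_code[OF ach, of "1 / 4" 1]) auto
  define K where "K = num_messages q n R"
  have K2: "K \<ge> 2" unfolding K_def using q R by (intro num_messages_ge_2) (use n in auto)
  then have K: "K > 0" by simp
  have enc: "is_encoder C q n K enc"
    and err: "\<And>Zrw Zro Zwo S J. admissible_sets C (zrw, zro, zwo) Zrw Zro Zwo \<Longrightarrow>
        error_prob q n K enc dec Zrw Zro Zwo S J < 1 / 4"
    using code unfolding secret_code_def K_def by auto
  define P where "P = message_codeword_pmf K enc"
  define mix where "mix A c c' = (\<lambda>i. if i \<in> A then c' i else c i)"
    for A :: "nat set" and c c' :: "nat \<Rightarrow> nat list"
  have mix_err: "pmf (do { (m, c) \<leftarrow> P; (m', c') \<leftarrow> P; return_pmf (dec (mix A c c') \<noteq> m) }) True < 1 / 4"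
    if A: "A \<subseteq> {..<C}" "card A \<le> zrw + zwo" for A
  proof -
    obtain Zrw Zwo where adm: "admissible_sets C (zrw, zro, zwo) Zrw {} Zwo" and V: "Zrw \<union> Zwo = A"
      using ex_jamming_sets[OF A, of zro] by auto
    \<comment> \<open>The fake codeword is drawn in advance and packed into the seed by
      \<open>to_nat\<close>; \<open>J\<close> unpacks it and ignores the observation. Its symbols
      lie below \<open>q\<close>, so the reduction modulo \<open>q\<close> leaves them
      unchanged.\<close>
    define S where "S = map_pmf (\<lambda>(m, c). to_nat (map c [0..<C])) P"
    define J where "J = (\<lambda>s i t (_ :: nat \<Rightarrow> nat list). (from_nat s :: nat list list) ! i ! t)"
    have rec: "received_ow q n Zr A J (to_nat (map c' [0..<C])) c = mix A c c'"
      if "codeword_tuple C q n c'" for c c' Zr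
    proof
      fix i
      show "received_ow q n Zr A J (to_nat (map c' [0..<C])) c i = mix A c c' i"
      proof (cases "i \<in> A")
        case True
        then have "i < C" using A(1) by auto
        then have "length (c' i) = n" "\<And>t. t < n \<Longrightarrow> c' i ! t < q"
          using that by (auto simp: codeword_tuple_def valid_word_def)
        then show ?thesis
          using True \<open>i < C\<close>
          by (auto simp: received_ow_def mix_def J_def intro!: nth_equalityI)
      qed (simp add: received_ow_def mix_def)
    qed
    have "error_prob q n K enc dec Zrw {} Zwo S J =
      pmf (do { (m, c) \<leftarrow> P; (m', c') \<leftarrow> P;
        return_pmf (dec (received_ow q n Zrw A J (to_nat (map c' [0..<C])) c) \<noteq> m) }) True"
      unfolding error_prob_eq P_def[symmetric] S_def V
      by (simp add: map_pmf_def bind_assoc_pmf bind_return_pmf case_prod_unfold)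
    also have "(do { (m, c) \<leftarrow> P; (m', c') \<leftarrow> P;
        return_pmf (dec (received_ow q n Zrw A J (to_nat (map c' [0..<C])) c) \<noteq> m) }) =
       (do { (m, c) \<leftarrow> P; (m', c') \<leftarrow> P; return_pmf (dec (mix A c c') \<noteq> m) })"
      using set_message_codeword_pmf[OF enc K]
      by (intro bind_pmf_cong refl) (auto simp: rec P_def intro!: bind_pmf_cong)
    finally show ?thesis using err[OF adm, of S J] by simp
  qed
  define A where "A = {..<zrw + zwo}"
  define A' where "A' = {zrw + zwo..<C}"
  define E where "E = (\<lambda>((m, c), (m' :: nat, c' :: nat \<Rightarrow> nat list)). dec (mix A c c') \<noteq> m)"
  define E' where "E' = (\<lambda>((m :: nat, c), (m', c')). dec (mix A c c') \<noteq> m')"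
  have 1: "pmf (map_pmf E (pair_pmf P P)) True < 1 / 4"
    using mix_err[of A] C unfolding A_def[symmetric]
    by (simp add: E_def pair_pmf_def map_bind_pmf case_prod_unfold A_def)
  have "pmf (do { (m, c) \<leftarrow> P; (m', c') \<leftarrow> P; return_pmf (dec (mix A' c c') \<noteq> m) }) True < 1 / 4"
    using C by (intro mix_err) (auto simp: A'_def)
  also have "(do { (m, c) \<leftarrow> P; (m', c') \<leftarrow> P; return_pmf (dec (mix A' c c') \<noteq> m) }) =
      (do { (m, c) \<leftarrow> P; (m', c') \<leftarrow> P; return_pmf (dec (mix A c' c) \<noteq> m) })"
  proof (intro bind_pmf_cong refl, clarify, intro bind_pmf_cong refl, clarify)
    fix m c m' c' assume "(m, c) \<in> set_pmf P" "(m', c') \<in> set_pmf P"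
    then have "codeword_tuple C q n c" "codeword_tuple C q n c'"
      unfolding P_def by (auto dest: set_message_codeword_pmf[OF enc K])
    then have "mix A' c c' = mix A c' c"
      using C by (auto simp: mix_def A_def A'_def codeword_tuple_def)
    then show "return_pmf (dec (mix A' c c') \<noteq> m) = return_pmf (dec (mix A c' c) \<noteq> m)"
      by simp
  qed
  \<comment> \<open>The two pairs are independent with the same law, so their roles can be
    exchanged.\<close>
  also have "\<dots> = do { (m', c') \<leftarrow> P; (m, c) \<leftarrow> P; return_pmf (dec (mix A c' c) \<noteq> m) }"
    by (simp add: case_prod_unfold) (rule bind_commute_pmf)
  also have "\<dots> = map_pmf E' (pair_pmf P P)"
    by (simp add: E'_def pair_pmf_def map_bind_pmf case_prod_unfold)
  finally have 2: "pmf (map_pmf E' (pair_pmf P P)) True < 1 / 4" .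
  let ?D = "\<lambda>(x, y). fst x \<noteq> fst y"
  \<comment> \<open>Two independent messages differ with probability (K - 1) / K, and a positive
    rate forces \<open>K\<close> >= 2.\<close>
  have "1 / 2 \<le> pmf (do { m \<leftarrow> pmf_of_set {..<K}; m' \<leftarrow> pmf_of_set {..<K}; return_pmf (m \<noteq> m') }) True"
  proof (rule pmf_bind_ge)
    fix m assume "m \<in> set_pmf (pmf_of_set {..<K})"
    have ne: "{..<K} \<noteq> {}" using K by auto
    have m: "m < K" using \<open>m \<in> _\<close> ne by simp
    have "pmf (map_pmf (\<lambda>m'. m \<noteq> m') (pmf_of_set {..<K})) True
        = real (card ({..<K} \<inter> {m'. m \<noteq> m'})) / real K"
      using ne by (simp add: pmf_map vimage_def measure_pmf_of_set)
    also have "{..<K} \<inter> {m'. m \<noteq> m'} = {..<K} - {m}" by auto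
    also have "real (card ({..<K} - {m})) / real K = (real K - 1) / real K"
      using m by (simp add: of_nat_diff)
    also have "\<dots> \<ge> 1 / 2"
      using K2 by (simp add: field_simps)
    finally show "1 / 2 \<le> pmf (pmf_of_set {..<K} \<bind> (\<lambda>m'. return_pmf (m \<noteq> m'))) True"
      by (simp add: map_pmf_def)
  qed
  also have "do { m \<leftarrow> pmf_of_set {..<K}; m' \<leftarrow> pmf_of_set {..<K}; return_pmf (m \<noteq> m') } =
      map_pmf ?D (pair_pmf P P)"
    unfolding fst_message_codeword_pmf[of K enc, symmetric] P_def[symmetric]
    by (simp add: pair_pmf_def map_bind_pmf bind_map_pmf)
  also have "pmf (map_pmf ?D (pair_pmf P P)) True = measure_pmf.prob (pair_pmf P P) {x. ?D x}"
    by (simp add: pmf_map vimage_def)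
  also have "\<dots> \<le> measure_pmf.prob (pair_pmf P P) ({x. E x} \<union> {x. E' x})"
    by (intro measure_pmf.finite_measure_mono) (auto simp: E_def E'_def)
  also have "\<dots> \<le> measure_pmf.prob (pair_pmf P P) {x. E x} + measure_pmf.prob (pair_pmf P P) {x. E' x}"
    by (intro measure_Un_le) auto
  also have "\<dots> = pmf (map_pmf E (pair_pmf P P)) True + pmf (map_pmf E' (pair_pmf P P)) True"
    by (simp add: pmf_map vimage_def)
  finally show False using 1 2 by simp
qed

section \<open>Secret sharing with delayed hashes\<close>

definition poly_hash :: "'f::field \<Rightarrow> 'f list \<Rightarrow> 'f" where
  "poly_hash r w = poly (Poly w) r"

text \<open>The first symbol is the constant coefficient, so a uniform first symbol acts as an
  additive one-time pad on the hash.\<close>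

lemma poly_hash_Cons: "poly_hash r (x # w) = x + r * poly_hash r w"
  by (simp add: poly_hash_def)

lemma (in finite_subfield) poly_hash_F:
  "r \<in> F \<Longrightarrow> set w \<subseteq> F \<Longrightarrow> poly_hash r w \<in> F"
  by (induction w) (auto simp: poly_hash_Cons poly_hash_def zero_F intro!: add_F mult_F)

text \<open>Since the lengths agree, different words give different polynomials, and their
  difference has degree at most \<open>d\<close>. Without equal lengths, trailing zeros would go
  unnoticed.\<close>

lemma poly_hash_collisions:
  assumes "length v = Suc d" "length w = Suc d" "v \<noteq> w"
  shows "finite {r. poly_hash r v = poly_hash r w}" "card {r. poly_hash r v = poly_hash r w} \<le> d"
proof -
  define p where "p = Poly v - Poly w"
  obtain i where i: "i < Suc d" "v ! i \<noteq> w ! i"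
    using assms by (metis nth_equalityI)
  have "coeff p i = v ! i - w ! i"
    using i(1) assms(1,2) by (simp add: p_def nth_default_def)
  then have nz: "p \<noteq> 0" using i(2) by auto
  have "degree p \<le> d"
    using assms(1,2) by (intro degree_le) (auto simp: p_def nth_default_def)
  moreover have "{r. poly_hash r v = poly_hash r w} = {r. poly p r = 0}"
    by (simp add: p_def poly_hash_def)
  ultimately show "finite {r. poly_hash r v = poly_hash r w}"
    "card {r. poly_hash r v = poly_hash r w} \<le> d"
    using card_poly_roots_bound[OF nz] poly_roots_finite[OF nz] by auto
qed

text \<open>For each of \<open>T\<close> time slots, the \<open>k\<close> message symbols are the values at
  \<open>a C, \<dots>, a (C + k - 1)\<close> of a random polynomial with \<open>k + zr\<close> coefficients, whose values at
  \<open>a 0, \<dots>, a (C - 1)\<close> are sent over the links.\<close>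

locale hashed_sharing = finite_subfield F for F :: "'f::field set" +
  fixes C k zr T K :: nat and a :: "nat \<Rightarrow> 'f" and \<phi> :: "nat \<Rightarrow> 'f"
    and \<mu> :: "nat \<Rightarrow> nat \<Rightarrow> nat \<Rightarrow> 'f"
  assumes inj_a: "inj_on a {..<C + k}"
    and a_F: "i < C + k \<Longrightarrow> a i \<in> F"
    and bij_\<phi>: "bij_betw \<phi> {..<card F} F"
    and \<mu>_F: "\<mu> m t j \<in> F"
    and \<mu>_inj: "m < K \<Longrightarrow> m' < K \<Longrightarrow> (\<And>t j. t < T \<Longrightarrow> j < k \<Longrightarrow> \<mu> m t j = \<mu> m' t j) \<Longrightarrow> m = m'"
    and K_pos: "K > 0"
begin

text \<open>\<open>\<phi>\<close> and \<open>\<psi>\<close> translate between the alphabet of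
  natural numbers and the field.\<close>

definition \<psi> :: "'f \<Rightarrow> nat" where
  "\<psi> = the_inv_into {..<card F} \<phi>"

lemma \<phi>_\<psi>: "x \<in> F \<Longrightarrow> \<phi> (\<psi> x) = x"
  unfolding \<psi>_def using bij_\<phi> by (simp add: bij_betw_def f_the_inv_into_f)

lemma \<psi>_less: "x \<in> F \<Longrightarrow> \<psi> x < card F"
  unfolding \<psi>_def using bij_betw_the_inv_into[OF bij_\<phi>] by (auto simp: bij_betw_def)

definition shares :: "nat \<Rightarrow> (nat \<Rightarrow> 'f poly) set" where
  "shares m = {f \<in> PiE {..<T} (\<lambda>_. polys (k + zr)).
     \<forall>t<T. \<forall>j<k. poly (f t) (a (C + j)) = \<mu> m t j}"

definition pads :: "(nat \<Rightarrow> 'f) set" where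
  "pads = PiE {..<C} (\<lambda>_. F)"

definition data :: "(nat \<Rightarrow> 'f poly) \<Rightarrow> nat \<Rightarrow> 'f list" where
  "data f i = map (\<lambda>t. poly (f t) (a i)) [0..<T]"

definition head :: "(nat \<Rightarrow> 'f poly) \<times> (nat \<Rightarrow> 'f) \<Rightarrow> nat \<Rightarrow> 'f list" where
  "head x i = snd x i # data (fst x) i"

definition tail :: "(nat \<Rightarrow> 'f poly) \<times> (nat \<Rightarrow> 'f) \<Rightarrow> 'f \<Rightarrow> 'f list" where
  "tail x r = r # map (\<lambda>j. poly_hash r (head x j)) [0..<C]"

definition codeword :: "(nat \<Rightarrow> 'f poly) \<times> (nat \<Rightarrow> 'f) \<Rightarrow> 'f \<Rightarrow> nat \<Rightarrow> nat list" where
  "codeword x r = (\<lambda>i. if i < C then map \<psi> (head x i @ tail x r) else [])"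

definition encoder :: "nat \<Rightarrow> (nat \<Rightarrow> nat list) pmf" where
  "encoder m = do { x \<leftarrow> pmf_of_set (shares m \<times> pads); r \<leftarrow> pmf_of_set F;
                    return_pmf (codeword x r) }"

text \<open>A strict majority fixes the common tail, whose entry 0 is \<open>r\<close> and whose
  entry \<open>Suc i\<close> is the hash of link \<open>i\<close>. \<open>G\<close> keeps the links
  whose head passes its hash, and \<open>tl\<close> strips the pad before looking for a message with
  a matching sharing.\<close>

definition decoder :: "(nat \<Rightarrow> nat list) \<Rightarrow> nat" where
  "decoder y = (let \<tau> = (SOME \<tau>. C < 2 * card {i. i < C \<and> drop (Suc T) (y i) = \<tau>});
      G = {i. i < C \<and> poly_hash (\<phi> (\<tau> ! 0)) (map \<phi> (take (Suc T) (y i))) = \<phi> (\<tau> ! Suc i)}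
    in SOME m. m < K \<and> (\<exists>f\<in>shares m. \<forall>i\<in>G. data f i = tl (map \<phi> (take (Suc T) (y i)))))"

lemma length_head [simp]: "length (head x i) = Suc T"
  by (simp add: head_def data_def)

lemma length_tail [simp]: "length (tail x r) = Suc C"
  by (simp add: tail_def)

lemma data_cong: "(\<And>t. t < T \<Longrightarrow> poly (f t) (a i) = poly (g t) (a i)) \<Longrightarrow> data f i = data g i"
  by (simp add: data_def)

lemma data_F: "f \<in> PiE {..<T} (\<lambda>_. polys d) \<Longrightarrow> i < C \<Longrightarrow> set (data f i) \<subseteq> F"
  using a_F[of i] poly_polys_F[of _ d "a i"] by (auto simp: data_def PiE_iff)

lemma head_F: "x \<in> shares m \<times> pads \<Longrightarrow> i < C \<Longrightarrow> set (head x i) \<subseteq> F"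
  using data_F[of "fst x" "k + zr" i] by (auto simp: head_def shares_def pads_def)

lemma tail_F: "x \<in> shares m \<times> pads \<Longrightarrow> r \<in> F \<Longrightarrow> set (tail x r) \<subseteq> F"
  using poly_hash_F[of r, OF _ head_F[of x m]] by (auto simp: tail_def)

lemma finite_shares: "finite (shares m)"
  unfolding shares_def
  by (rule finite_subset[of _ "PiE {..<T} (\<lambda>_. polys (k + zr))"])
     (auto simp: finite_polys intro!: finite_PiE)

lemma finite_pads: "finite pads"
  unfolding pads_def by (intro finite_PiE) (auto simp: finite_F)

lemma pads_nonempty: "pads \<noteq> {}"
  unfolding pads_def using zero_F by (auto simp: PiE_eq_empty_iff)

lemma F_nonempty: "F \<noteq> {}"
  using zero_F by auto

text \<open>At most \<open>zr\<close> links and \<open>k\<close> secret positions give at most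
  \<open>k + zr\<close> nodes per slot, as many as there are coefficients. With \<open>Z\<close>
  empty it shows that sharings exist; otherwise it supplies a change of message invisible on
  \<open>Z\<close>.\<close>

lemma share_interpolation:
  assumes "Z \<subseteq> {..<C}" "card Z \<le> zr" "\<And>t j. y t j \<in> F"
  shows "\<exists>g\<in>PiE {..<T} (\<lambda>_. polys (k + zr)). \<forall>t<T.
      (\<forall>i\<in>Z. poly (g t) (a i) = 0) \<and> (\<forall>j<k. poly (g t) (a (C + j)) = y t j)"
proof -
  define I where "I = Z \<union> {C..<C + k}"
  have fin: "finite I" using assms(1) finite_subset by (auto simp: I_def)
  have "card I \<le> k + zr"
    using card_Un_le[of Z "{C..<C + k}"] assms(2) by (simp add: I_def)
  have sub: "I \<subseteq> {..<C + k}" using assms(1) by (auto simp: I_def)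
  have ex: "\<exists>p. p \<in> polys (k + zr) \<and> (\<forall>i\<in>I. poly p (a i) = (if i < C then 0 else y t (i - C)))" for t
  proof -
    have "\<exists>p\<in>polys (card I). \<forall>i\<in>I. poly p (a i) = (if i < C then 0 else y t (i - C))"
      using sub assms(3) zero_F
      by (intro interpolation fin inj_on_subset[OF inj_a sub]) (auto intro!: a_F)
    then show ?thesis using polys_mono[OF \<open>card I \<le> k + zr\<close>] by blast
  qed
  then obtain g where g: "\<And>t. g t \<in> polys (k + zr)"
    "\<And>t i. i \<in> I \<Longrightarrow> poly (g t) (a i) = (if i < C then 0 else y t (i - C))"
    by metis
  show ?thesis
    using g assms(1) by (intro bexI[of _ "restrict g {..<T}"]) (auto simp: I_def)
qed

lemma shares_nonempty: "shares m \<noteq> {}"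
proof -
  obtain g where "g \<in> PiE {..<T} (\<lambda>_. polys (k + zr))"
    "\<forall>t<T. (\<forall>i\<in>{}. poly (g t) (a i) = 0) \<and> (\<forall>j<k. poly (g t) (a (C + j)) = \<mu> m t j)"
    using share_interpolation[of "{}" "\<mu> m", OF _ _ \<mu>_F] by auto
  then have "g \<in> shares m" by (simp add: shares_def)
  then show ?thesis by auto
qed

lemma set_encoder:
  assumes "c \<in> set_pmf (encoder m)"
  obtains x r where "x \<in> shares m \<times> pads" "r \<in> F" "c = codeword x r"
proof -
  have "set_pmf (pmf_of_set (shares m \<times> pads)) = shares m \<times> pads" "set_pmf (pmf_of_set F) = F"
    using finite_shares finite_pads shares_nonempty pads_nonempty finite_F F_nonempty
    by (auto intro!: set_pmf_of_set)
  then have "\<exists>x\<in>shares m \<times> pads. \<exists>r\<in>F. c = codeword x r"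
    using assms unfolding encoder_def by simp
  then show thesis using that by blast
qed

text \<open>The length counts one pad, \<open>T\<close> data symbols, the point \<open>r\<close> and
  \<open>C\<close> hashes.\<close>

lemma is_encoder_encoder: "is_encoder C (card F) (T + C + 2) K encoder"
  unfolding is_encoder_def
proof (intro allI impI ballI)
  fix m c assume "c \<in> set_pmf (encoder m)"
  then obtain x r where xr: "x \<in> shares m \<times> pads" "r \<in> F" "c = codeword x r"
    by (rule set_encoder)
  then show "codeword_tuple C (card F) (T + C + 2) c"
    using head_F[OF xr(1)] tail_F[OF xr(1,2)]
    by (auto simp: codeword_tuple_def valid_word_def codeword_def intro!: \<psi>_less)
qed

section \<open>Secrecy of the sharing\<close>

text \<open>Shifting the polynomials by \<open>g\<close> while correcting the pads so that no hash changes.\<close>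

definition shift :: "(nat \<Rightarrow> 'f poly) \<Rightarrow> 'f \<Rightarrow> (nat \<Rightarrow> 'f poly) \<times> (nat \<Rightarrow> 'f) \<Rightarrow>
    (nat \<Rightarrow> 'f poly) \<times> (nat \<Rightarrow> 'f)" where
  "shift g r x = (\<lambda>t\<in>{..<T}. fst x t + g t,
     \<lambda>i\<in>{..<C}. snd x i + r * (poly_hash r (data (fst x) i) -
       poly_hash r (data (\<lambda>t\<in>{..<T}. fst x t + g t) i)))"

lemma shift_mem:
  assumes "x \<in> shares m \<times> pads" "r \<in> F" "\<And>t. t < T \<Longrightarrow> g t \<in> polys (k + zr)"
    and "\<And>t j. t < T \<Longrightarrow> j < k \<Longrightarrow> poly (g t) (a (C + j)) = \<mu> m' t j - \<mu> m t j"
  shows "shift g r x \<in> shares m' \<times> pads"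
proof -
  define f where "f = (\<lambda>t\<in>{..<T}. fst x t + g t)"
  have f: "f \<in> PiE {..<T} (\<lambda>_. polys (k + zr))"
    using assms by (auto simp: f_def shares_def intro!: add_polys)
  have "f \<in> shares m'"
    using f assms by (auto simp: shares_def f_def)
  moreover have "(\<lambda>i\<in>{..<C}. snd x i + r * (poly_hash r (data (fst x) i) - poly_hash r (data f i))) \<in> pads"
  proof -
    have "poly_hash r (data f i) \<in> F" "poly_hash r (data (fst x) i) \<in> F" if "i < C" for i
      using assms(1,2) that data_F[OF f that] data_F[of "fst x" "k + zr" i]
      by (simp_all add: shares_def mem_Times_iff poly_hash_F)
    then show ?thesis
      using assms(1,2) by (auto simp: pads_def intro!: add_F mult_F diff_F)
  qed
  ultimately show ?thesis by (simp add: shift_def f_def)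
qed

text \<open>Provides the inverse that makes \<open>shift\<close> a bijection; both components are
  extensional, so agreement on the index sets suffices.\<close>

lemma shift_uminus_shift:
  assumes "x \<in> shares m \<times> pads"
  shows "shift (\<lambda>t. - g t) r (shift g r x) = x"
proof -
  have ext: "fst x \<in> extensional {..<T}" "snd x \<in> extensional {..<C}"
    using assms by (auto simp: shares_def pads_def PiE_def)
  have 1: "(\<lambda>t\<in>{..<T}. fst (shift g r x) t + - g t) = fst x"
    using ext(1) by (intro extensionalityI[of _ "{..<T}"]) (auto simp: shift_def)
  have "snd (shift (\<lambda>t. - g t) r (shift g r x)) = snd x"
    using ext(2) unfolding shift_def[of "\<lambda>t. - g t"] 1
    by (intro extensionalityI[of _ "{..<C}"]) (auto simp: shift_def algebra_simps)
  with 1 show ?thesis by (intro prod_eqI) (simp_all add: shift_def[of "\<lambda>t. - g t"])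
qed

text \<open>On \<open>Z\<close> the data are unchanged, so the pad correction is zero there and the
  heads agree. Everywhere else the correction preserves the hashes, and the tail depends only on
  these and \<open>r\<close>.\<close>

lemma codeword_shift:
  assumes "i \<in> Z" "\<And>i t. i \<in> Z \<Longrightarrow> t < T \<Longrightarrow> poly (g t) (a i) = 0"
  shows "codeword (shift g r x) r i = codeword x r i"
proof (cases "i < C")
  case True
  have "data (\<lambda>t\<in>{..<T}. fst x t + g t) i = data (fst x) i"
    using assms by (intro data_cong) auto
  then have "head (shift g r x) i = head x i"
    using True by (simp add: head_def shift_def)
  moreover have "poly_hash r (head (shift g r x) j) = poly_hash r (head x j)" if "j < C" for j
    using that by (simp add: head_def shift_def poly_hash_Cons algebra_simps)
  then have "tail (shift g r x) r = tail x r"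
    by (simp add: tail_def)
  ultimately show ?thesis by (simp add: codeword_def)
qed (simp add: codeword_def)

text \<open>For each fixed \<open>r\<close>, a suitable shift is a bijection between the randomness
  used for \<open>m\<close> and that used for \<open>m'\<close>, and it preserves the view on
  \<open>Z\<close>.\<close>

lemma encoder_view_eq:
  assumes "Z \<subseteq> {..<C}" "card Z \<le> zr"
  shows "map_pmf (\<lambda>c i. if i \<in> Z then c i else []) (encoder m) =
         map_pmf (\<lambda>c i. if i \<in> Z then c i else []) (encoder m')"
proof -
  define view where "view = (\<lambda>(c :: nat \<Rightarrow> nat list) i. if i \<in> Z then c i else [])"
  have fin: "finite (shares m \<times> pads)" "shares m \<times> pads \<noteq> {}" for m
    using finite_shares finite_pads shares_nonempty pads_nonempty by auto
  \<comment> \<open>\<open>g\<close> vanishes on the observed links and carries the secret values of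
    \<open>m\<close> to those of \<open>m'\<close>.\<close>
  obtain g where "\<forall>t<T. (\<forall>i\<in>Z. poly (g t) (a i) = 0) \<and>
      (\<forall>j<k. poly (g t) (a (C + j)) = \<mu> m' t j - \<mu> m t j)"
    and "g \<in> PiE {..<T} (\<lambda>_. polys (k + zr))"
    using share_interpolation[OF assms, of "\<lambda>t j. \<mu> m' t j - \<mu> m t j", OF diff_F[OF \<mu>_F \<mu>_F]]
    by (elim bexE)
  then have g: "\<And>t. t < T \<Longrightarrow> g t \<in> polys (k + zr)"
    "\<And>i t. i \<in> Z \<Longrightarrow> t < T \<Longrightarrow> poly (g t) (a i) = 0"
    "\<And>t j. t < T \<Longrightarrow> j < k \<Longrightarrow> poly (g t) (a (C + j)) = \<mu> m' t j - \<mu> m t j"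
    by auto
  have g': "- g t \<in> polys (k + zr)" if "t < T" for t
    using diff_polys[OF zero_polys g(1)[OF that]] by simp
  have "map_pmf (\<lambda>x. view (codeword x r)) (pmf_of_set (shares m \<times> pads)) =
      map_pmf (\<lambda>x. view (codeword x r)) (pmf_of_set (shares m' \<times> pads))" if r: "r \<in> F" for r
  proof -
    have "bij_betw (shift g r) (shares m \<times> pads) (shares m' \<times> pads)"
    proof (rule bij_betw_byWitness[where f' = "shift (\<lambda>t. - g t) r"])
      show "\<forall>x\<in>shares m \<times> pads. shift (\<lambda>t. - g t) r (shift g r x) = x"
        using shift_uminus_shift by blast
      show "\<forall>x\<in>shares m' \<times> pads. shift g r (shift (\<lambda>t. - g t) r x) = x"
        using shift_uminus_shift[where g = "\<lambda>t. - g t"] by simp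
      show "shift g r ` (shares m \<times> pads) \<subseteq> shares m' \<times> pads"
        using shift_mem[OF _ r g(1,3)] by blast
      show "shift (\<lambda>t. - g t) r ` (shares m' \<times> pads) \<subseteq> shares m \<times> pads"
        using shift_mem[where m = m' and m' = m, OF _ r g'] g(3) by (simp add: image_subset_iff)
    qed
    then have "pmf_of_set (shares m' \<times> pads) = map_pmf (shift g r) (pmf_of_set (shares m \<times> pads))"
      using fin by (simp add: map_pmf_of_set_bij_betw)
    moreover have "view (codeword (shift g r x) r) = view (codeword x r)" for x
      unfolding view_def using codeword_shift[where Z = Z and g = g] g(2) by (intro ext) simp
    ultimately show ?thesis by (simp add: pmf.map_comp o_def)
  qed
  then have eq: "pmf_of_set F \<bind> (\<lambda>r. map_pmf (\<lambda>x. view (codeword x r)) (pmf_of_set (shares m \<times> pads))) =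
      pmf_of_set F \<bind> (\<lambda>r. map_pmf (\<lambda>x. view (codeword x r)) (pmf_of_set (shares m' \<times> pads)))"
    using finite_F F_nonempty by (intro bind_pmf_cong) auto
  \<comment> \<open>The independent draws of \<open>x\<close> and \<open>r\<close> are exchanged,
    because the bijection depends on \<open>r\<close>.\<close>
  have "map_pmf view (encoder m) =
      pmf_of_set F \<bind> (\<lambda>r. map_pmf (\<lambda>x. view (codeword x r)) (pmf_of_set (shares m \<times> pads)))" for m
    unfolding encoder_def map_pmf_def bind_assoc_pmf bind_return_pmf by (rule bind_commute_pmf)
  then show ?thesis using eq by (simp add: view_def)
qed

lemma mutual_info_encoder:
  assumes "Z \<subseteq> {..<C}" "card Z \<le> zr"
  shows "mutual_info (msg_obs_dist K encoder Z) = 0"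
proof -
  define view where "view = (\<lambda>(c :: nat \<Rightarrow> nat list) i. if i \<in> Z then c i else [])"
  have "msg_obs_dist K encoder Z =
      pmf_of_set {..<K} \<bind> (\<lambda>m. map_pmf view (encoder m) \<bind> (\<lambda>v. return_pmf (m, v)))"
    by (simp add: msg_obs_dist_def view_def bind_map_pmf)
  also have "\<dots> = pair_pmf (pmf_of_set {..<K}) (map_pmf view (encoder 0))"
    unfolding pair_pmf_def view_def by (subst encoder_view_eq[OF assms, of _ 0]) simp
  finally show ?thesis by (simp add: mutual_info_pair_pmf)
qed

text \<open>The probability-free core: once no tampered head passes its hash, every link in
  \<open>G\<close> carries its true head, and \<open>G\<close> contains all clean links.\<close>

lemma decoder_correct:
  assumes m: "m < K" and x: "x \<in> shares m \<times> pads" and r: "r \<in> F"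
    and V: "2 * card V < C" "card V + (k + zr) \<le> C" "V \<subseteq> {..<C}"
    and clean: "\<And>i. i < C \<Longrightarrow> i \<notin> V \<Longrightarrow> y i = codeword x r i"
    and detect: "\<And>i. i \<in> V \<Longrightarrow>
      poly_hash r (map \<phi> (take (Suc T) (y i))) = poly_hash r (head x i) \<Longrightarrow>
      map \<phi> (take (Suc T) (y i)) = head x i"
  shows "decoder y = m"
proof -
  define \<tau> where "\<tau> = map \<psi> (tail x r)"
  let ?A = "\<lambda>\<tau>. {i. i < C \<and> drop (Suc T) (y i) = \<tau>}"
  have fin_V: "finite V" using V(3) finite_subset by blast
  have card_clean: "card ({..<C} - V) = C - card V"
    using V(3) fin_V by (simp add: card_Diff_subset)
  have "{..<C} - V \<subseteq> ?A \<tau>"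
    using clean by (auto simp: codeword_def \<tau>_def)
  then have "C - card V \<le> card (?A \<tau>)"
    unfolding card_clean[symmetric] by (intro card_mono) auto
  then have maj: "C < 2 * card (?A \<tau>)" using V(1) by linarith
  \<comment> \<open>Two different tails cannot both be held by more than half of the links.\<close>
  have "(SOME \<tau>. C < 2 * card (?A \<tau>)) = \<tau>"
  proof (rule some_equality[of "\<lambda>\<tau>. C < 2 * card (?A \<tau>)", OF maj])
    fix \<tau>' assume maj': "C < 2 * card (?A \<tau>')"
    show "\<tau>' = \<tau>"
    proof (rule ccontr)
      assume "\<tau>' \<noteq> \<tau>"
      then have "card (?A \<tau>' \<union> ?A \<tau>) = card (?A \<tau>') + card (?A \<tau>)"
        by (intro card_Un_disjoint) auto
      moreover have "card (?A \<tau>' \<union> ?A \<tau>) \<le> card {..<C}"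
        by (intro card_mono) auto
      ultimately show False using maj maj' by simp
    qed
  qed
  note some_\<tau> = this
  have hash_F: "poly_hash r (head x i) \<in> F" if "i < C" for i
    using head_F[OF x that] r by (simp add: poly_hash_F)
  have \<tau>_nth: "\<phi> (\<tau> ! 0) = r" "\<And>i. i < C \<Longrightarrow> \<phi> (\<tau> ! Suc i) = poly_hash r (head x i)"
    using r hash_F by (simp_all add: \<tau>_def tail_def \<phi>_\<psi>)
  define G where "G = {i. i < C \<and> poly_hash (\<phi> (\<tau> ! 0)) (map \<phi> (take (Suc T) (y i))) = \<phi> (\<tau> ! Suc i)}"
  have clean_head: "map \<phi> (take (Suc T) (y i)) = head x i" if "i < C" "i \<notin> V" for i
  proof -
    have "map \<phi> (map \<psi> (head x i)) = head x i"
      using head_F[OF x that(1)] by (auto simp: map_idI \<phi>_\<psi> subset_iff)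
    then show ?thesis using clean[OF that] that(1) by (simp add: codeword_def)
  qed
  have G_head: "map \<phi> (take (Suc T) (y i)) = head x i" if "i \<in> G" for i
    using that clean_head[of i] detect[of i] by (cases "i \<in> V") (auto simp: G_def \<tau>_nth)
  have G_sub: "{..<C} - V \<subseteq> G"
    using clean_head by (auto simp: G_def \<tau>_nth)
  have "G \<subseteq> {..<C + k}" by (auto simp: G_def)
  have card_G: "k + zr \<le> card (a ` G)"
  proof -
    have "C - card V \<le> card G"
      unfolding card_clean[symmetric] using G_sub by (intro card_mono) (auto simp: G_def)
    also have "card G = card (a ` G)"
      using inj_on_subset[OF inj_a \<open>G \<subseteq> {..<C + k}\<close>] by (simp add: card_image)
    finally show ?thesis using V(2) by linarith
  qed
  have x': "fst x \<in> shares m" using x by auto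
  have "decoder y = (SOME m. m < K \<and> (\<exists>f\<in>shares m. \<forall>i\<in>G. data f i = tl (map \<phi> (take (Suc T) (y i)))))"
    unfolding decoder_def Let_def some_\<tau> G_def ..
  also have "\<dots> = (SOME m. m < K \<and> (\<exists>f\<in>shares m. \<forall>i\<in>G. data f i = data (fst x) i))"
    using G_head by (intro arg_cong[where f = Eps] ext) (auto simp: head_def)
  also have "\<dots> = m"
  proof (rule some_equality)
    show "m < K \<and> (\<exists>f\<in>shares m. \<forall>i\<in>G. data f i = data (fst x) i)"
      using m x' by blast
    fix m' assume "m' < K \<and> (\<exists>f\<in>shares m'. \<forall>i\<in>G. data f i = data (fst x) i)"
    then obtain f where f: "m' < K" "f \<in> shares m'" "\<And>i. i \<in> G \<Longrightarrow> data f i = data (fst x) i"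
      by blast
    \<comment> \<open>\<open>G\<close> contains at least \<open>k + zr\<close> links, so any sharing
      that fits them is the one sent, and its values at the secret points identify the
      message.\<close>
    have "f t = fst x t" if "t < T" for t
    proof (rule polys_eqI[where A = "a ` G"])
      show "f t \<in> polys (k + zr)" "fst x t \<in> polys (k + zr)"
        using f(2) x' that by (auto simp: shares_def)
      show "a ` G \<subseteq> F" using \<open>G \<subseteq> {..<C + k}\<close> a_F by auto
      show "poly (f t) z = poly (fst x t) z" if "z \<in> a ` G" for z
        using that f(3) \<open>t < T\<close> by (auto simp: data_def)
    qed (rule card_G)
    then show "m' = m"
      using f(1,2) x' m by (intro \<mu>_inj) (auto simp: shares_def)
  qed
  finally show ?thesis .
qed

text \<open>Causality: Calvin fixes the heads of the jammed words before the evaluation point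
  \<open>r\<close> of the hash is sent.\<close>

lemma take_received_ow:
  assumes "i \<in> V"
  shows "take (Suc T) (received_ow q (T + C + 2) Zr V J s (codeword x r) i) =
    map (\<lambda>t. J s i t (observation Zr (\<lambda>j. if j < C then map \<psi> (head x j) else []) t) mod q) [0..<Suc T]"
proof -
  have "observation Zr (codeword x r) t = observation Zr (\<lambda>j. if j < C then map \<psi> (head x j) else []) t"
    if "t < Suc T" for t
    using that unfolding observation_def codeword_def by (intro ext) simp
  moreover have "take (Suc T) [0..<T + C + 2] = [0..<Suc T]"
    by (subst take_upt) auto
  ultimately show ?thesis
    using assms by (simp add: received_ow_def take_map del: upt_Suc)
qed

text \<open>With \<open>x\<close> and Calvin's seed fixed, the substituted heads do not depend on
  \<open>r\<close>. Each false head collides with the true hash for at most \<open>T\<close> values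
  of \<open>r\<close>, and a union bound over at most \<open>C\<close> jammed links remains.\<close>

lemma error_prob_le:
  assumes V: "2 * card (Zrw \<union> Zwo) < C" "card (Zrw \<union> Zwo) + (k + zr) \<le> C" "Zrw \<union> Zwo \<subseteq> {..<C}"
  shows "error_prob (card F) (T + C + 2) K encoder decoder Zrw Zro Zwo S J \<le> real (C * T) / real (card F)"
proof -
  define V where "V = Zrw \<union> Zwo"
  let ?rec = "\<lambda>s x r. received_ow (card F) (T + C + 2) (Zrw \<union> Zro) V J s (codeword x r)"
  have fin_V: "finite V" "card V \<le> C"
    using finite_subset[OF V(3)] V(1) unfolding V_def by simp_all
  have main: "pmf (map_pmf (\<lambda>r. decoder (?rec s x r) \<noteq> m) (pmf_of_set F)) True
      \<le> real (C * T) / real (card F)"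
    if m: "m < K" and x: "x \<in> shares m \<times> pads" for m x s
  proof -
    define w where "w i = map \<phi> (map (\<lambda>t. J s i t (observation (Zrw \<union> Zro)
        (\<lambda>j. if j < C then map \<psi> (head x j) else []) t) mod card F) [0..<Suc T])" for i
    have len: "length (w i) = Suc T" for i by (simp add: w_def)
    define Bad where "Bad i = (if w i = head x i then {} else {r. poly_hash r (w i) = poly_hash r (head x i)})" for i
    have Bad: "finite (Bad i)" "card (Bad i) \<le> T" for i
      using poly_hash_collisions[OF len[of i] length_head[of x i]] by (auto simp: Bad_def)
    have "F \<inter> {r. decoder (?rec s x r) \<noteq> m} \<subseteq> (\<Union>i\<in>V. Bad i)"
    proof (rule subsetI, rule ccontr)
      fix r assume r: "r \<in> F \<inter> {r. decoder (?rec s x r) \<noteq> m}" "r \<notin> (\<Union>i\<in>V. Bad i)"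
      have "decoder (?rec s x r) = m"
      proof (rule decoder_correct[OF m x _ V[folded V_def]])
        show "r \<in> F" using r(1) by simp
        show "?rec s x r i = codeword x r i" if "i \<notin> V" for i
          using that by (simp add: received_ow_def)
        fix i assume i: "i \<in> V"
          "poly_hash r (map \<phi> (take (Suc T) (?rec s x r i))) = poly_hash r (head x i)"
        have w: "map \<phi> (take (Suc T) (?rec s x r i)) = w i"
          unfolding take_received_ow[OF i(1)] w_def ..
        show "map \<phi> (take (Suc T) (?rec s x r i)) = head x i"
          using i r(2) unfolding w by (auto simp: Bad_def split: if_splits)
      qed
      then show False using r(1) by simp
    qed
    then have "card (F \<inter> {r. decoder (?rec s x r) \<noteq> m}) \<le> card (\<Union>i\<in>V. Bad i)"
      using fin_V Bad by (intro card_mono) auto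
    also have "\<dots> \<le> (\<Sum>i\<in>V. card (Bad i))"
      by (rule card_UN_le[OF fin_V(1)])
    also have "\<dots> \<le> card V * T"
      using sum_bounded_above[of V "\<lambda>i. card (Bad i)" T] Bad(2) by simp
    also have "\<dots> \<le> C * T" using fin_V(2) by simp
    finally have "real (card (F \<inter> {r. decoder (?rec s x r) \<noteq> m})) \<le> real (C * T)"
      by (simp only: of_nat_le_iff)
    then show ?thesis
      using finite_F F_nonempty
      by (simp add: pmf_map vimage_def measure_pmf_of_set divide_right_mono del: of_nat_mult)
  qed
  have "pmf (encoder m \<bind> (\<lambda>c. S \<bind> (\<lambda>s. return_pmf
      (decoder (received_ow (card F) (T + C + 2) (Zrw \<union> Zro) V J s c) \<noteq> m)))) True
      \<le> real (C * T) / real (card F)" if m: "m < K" for m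
    unfolding encoder_def bind_assoc_pmf bind_return_pmf
  proof (rule pmf_bind_le)
    fix x assume "x \<in> set_pmf (pmf_of_set (shares m \<times> pads))"
    then have x: "x \<in> shares m \<times> pads"
      using finite_shares finite_pads shares_nonempty pads_nonempty by auto
    \<comment> \<open>Calvin's seed is independent of \<open>r\<close>, so it can be drawn first and
      held fixed.\<close>
    show "pmf (pmf_of_set F \<bind> (\<lambda>r. S \<bind> (\<lambda>s. return_pmf (decoder (?rec s x r) \<noteq> m)))) True
        \<le> real (C * T) / real (card F)"
      by (subst bind_commute_pmf, rule pmf_bind_le) (use main[OF m x] in \<open>simp add: map_pmf_def\<close>)
  qed
  moreover have "set_pmf (pmf_of_set {..<K}) = {..<K}"
    using K_pos by (intro set_pmf_of_set) auto
  ultimately show ?thesis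
    unfolding error_prob_def V_def measure_pmf_single by - (rule pmf_bind_le, simp)
qed

end

section \<open>Choice of parameters and the capacity\<close>

lemma achievable_ge:
  assumes C: "2 * zwo + 2 * zrw < C" and k: "k + (zrw + zro) + (zrw + zwo) = C"
    and R: "0 \<le> R" "R < real k"
  shows "achievable_ow_secret C (zrw, zro, zwo) R"
  unfolding achievable_ow_secret_iff
proof (intro conjI allI impI R(1))
  fix \<epsilon> :: real assume \<epsilon>: "\<epsilon> > 0"
  \<comment> \<open>Pads, \<open>r\<close> and hashes cost \<open>C + 2\<close> slots. From this
    block length on, the other \<open>T\<close> slots with \<open>k\<close> symbols each still carry
    rate \<open>R\<close>, which lies strictly below \<open>k\<close>.\<close>
  define N where "N = max (C + 2) (nat \<lceil>real ((C + 2) * k) / (real k - R)\<rceil>)"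
  have "\<exists>q\<ge>2. \<exists>enc dec. secret_code C (zrw, zro, zwo) q n (num_messages q n R) \<epsilon> enc dec"
    if n: "n \<ge> N" for n
  proof -
    define T where "T = n - (C + 2)"
    have "C + 2 \<le> n" using n by (simp add: N_def)
    then have n_eq: "n = T + C + 2" by (simp add: T_def)
    have "real n \<ge> real ((C + 2) * k) / (real k - R)"
      using n unfolding N_def by linarith
    then have "real n * (real k - R) \<ge> real ((C + 2) * k)"
      using R by (simp add: field_simps)
    then have rate: "real n * R \<le> real (T * k)"
      by (simp add: n_eq algebra_simps)
    \<comment> \<open>The field order 2^\<open>B\<close> exceeds \<open>B\<close>, which leaves room
      for \<open>C + k\<close> distinct evaluation points and pushes the error bound C * T / q below
      \<open>\<epsilon>\<close>.\<close>
    define B where "B = C + k + 2 + nat \<lceil>real (C * T) / \<epsilon>\<rceil>"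
    obtain F :: "bit alg_closure set" where F: "finite_subfield F" "card F = 2 ^ B"
      using ex_finite_subfield[of B] by (auto simp: B_def)
    define q where "q = card F"
    have "q > B" unfolding q_def F(2) by (rule less_exp)
    have q2: "q \<ge> 2" and qCk: "C + k \<le> q" using \<open>q > B\<close> by (auto simp: B_def)
    have "real q > real (C * T) / \<epsilon>" using \<open>q > B\<close> unfolding B_def by linarith
    then have small: "real (C * T) / real q < \<epsilon>"
      using \<epsilon> q2 by (simp add: field_simps)
    define K where "K = num_messages q n R"
    have K_pos: "K > 0" unfolding K_def using q2 by (rule num_messages_pos)
    have "real q powr (real n * R) \<le> real q powr real (T * k)"
      using rate q2 by (intro powr_mono) auto
    also have "\<dots> = real (q ^ (T * k))"
      using q2 by (simp add: powr_realpow[symmetric])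
    finally have K_le: "K \<le> q ^ (T * k)"
      unfolding K_def num_messages_def by linarith
    interpret finite_subfield F by (rule F(1))
    obtain a where a: "inj_on a {..<C + k}" "a ` {..<C + k} \<subseteq> F"
      using inj_on_iff_card_le[of "{..<C + k}" F] finite_F qCk by (auto simp: q_def)
    obtain \<phi> where \<phi>: "bij_betw \<phi> {..<card F} F"
      using ex_bij_betw_nat_finite[OF finite_F] by (auto simp: atLeast0LessThan)
    define M where "M = PiE ({..<T} \<times> {..<k}) (\<lambda>_. F)"
    have "card M = q ^ (T * k)"
      unfolding M_def by (subst card_PiE) (auto simp: q_def)
    moreover have "finite M" unfolding M_def by (intro finite_PiE) (auto simp: finite_F)
    ultimately obtain \<nu> where \<nu>: "inj_on \<nu> {..<K}" "\<nu> ` {..<K} \<subseteq> M"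
      using inj_on_iff_card_le[of "{..<K}" M] K_le by auto
    \<comment> \<open>Messages are injected into arrays of \<open>T * k\<close> field elements; the
      default 0 keeps \<open>\<mu>\<close> in \<open>F\<close> for all arguments.\<close>
    define \<mu> where "\<mu> m t j = (if m < K \<and> t < T \<and> j < k then \<nu> m (t, j) else 0)" for m t j
    interpret hashed_sharing F C k "zrw + zro" T K a \<phi> \<mu>
    proof
      show "inj_on a {..<C + k}" "bij_betw \<phi> {..<card F} F" "K > 0" by fact+
      show "a i \<in> F" if "i < C + k" for i using a(2) that by auto
      show "\<mu> m t j \<in> F" for m t j
        using \<nu>(2) zero_F by (auto simp: \<mu>_def M_def)
      show "m = m'" if "m < K" "m' < K" "\<And>t j. t < T \<Longrightarrow> j < k \<Longrightarrow> \<mu> m t j = \<mu> m' t j" for m m'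
      proof -
        have "\<nu> m = \<nu> m'"
        proof (rule PiE_ext)
          show "\<nu> m \<in> PiE ({..<T} \<times> {..<k}) (\<lambda>_. F)" "\<nu> m' \<in> PiE ({..<T} \<times> {..<k}) (\<lambda>_. F)"
            using \<nu>(2) that(1,2) by (auto simp: M_def)
          show "\<nu> m z = \<nu> m' z" if "z \<in> {..<T} \<times> {..<k}" for z
            using that \<open>m < K\<close> \<open>m' < K\<close> \<open>\<And>t j. t < T \<Longrightarrow> j < k \<Longrightarrow> \<mu> m t j = \<mu> m' t j\<close>[of "fst z" "snd z"]
            by (auto simp: \<mu>_def)
        qed
        then show ?thesis using \<nu>(1) that(1,2) by (auto dest: inj_onD)
      qed
    qed
    have "secret_code C (zrw, zro, zwo) q n K \<epsilon> encoder decoder"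
      unfolding secret_code_def
    proof (intro conjI allI impI)
      show "is_encoder C q n K encoder"
        using is_encoder_encoder by (simp add: n_eq q_def)
      show "mutual_info (msg_obs_dist K encoder Z) = 0"
        if "Z \<subseteq> {..<C} \<and> card Z \<le> fst (zrw, zro, zwo) + fst (snd (zrw, zro, zwo))" for Z
        using that by (intro mutual_info_encoder) auto
      fix Zrw Zro Zwo S J assume "admissible_sets C (zrw, zro, zwo) Zrw Zro Zwo"
      then have adm: "Zrw \<union> Zwo \<subseteq> {..<C}" "card Zrw \<le> zrw" "card Zwo \<le> zwo"
        by (auto simp: admissible_sets_def)
      have card_V: "card (Zrw \<union> Zwo) \<le> zrw + zwo"
        using card_Un_le[of Zrw Zwo] adm by linarith
      have "error_prob q n K encoder decoder Zrw Zro Zwo S J \<le> real (C * T) / real q"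
        unfolding n_eq q_def using C k adm(1) card_V by (intro error_prob_le) linarith+
      with small show "error_prob q n K encoder decoder Zrw Zro Zwo S J < \<epsilon>" by simp
    qed
    then show ?thesis using q2 unfolding K_def by blast
  qed
  then show "\<exists>N. \<forall>n\<ge>N. \<exists>q\<ge>2. \<exists>enc dec. secret_code C (zrw, zro, zwo) q n (num_messages q n R) \<epsilon> enc dec"
    by (rule exI[where x = N, OF allI, OF impI])
qed

text \<open>At rate 0 there is a single message, so a constant code is both secret and error-free.
  This keeps the supremum from being taken over the empty set.\<close>

lemma achievable_zero: "achievable_ow_secret C z 0"
  unfolding achievable_ow_secret_iff
proof (intro conjI allI impI)
  fix \<epsilon> :: real assume \<epsilon>: "\<epsilon> > 0"
  have "\<exists>q\<ge>2. \<exists>enc dec. secret_code C z q n (num_messages q n 0) \<epsilon> enc dec" for n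
  proof -
    let ?c = "\<lambda>i. if i < C then replicate n 0 else [] :: nat list"
    have one: "num_messages 2 n 0 = 1" by (simp add: num_messages_def)
    have single: "pmf_of_set {..<1 :: nat} = return_pmf 0"
      by (simp add: pmf_of_set_singleton lessThan_Suc)
    have "secret_code C z 2 n 1 \<epsilon> (\<lambda>_. return_pmf ?c) (\<lambda>_. 0)"
      unfolding secret_code_def
    proof (intro conjI allI impI)
      show "is_encoder C 2 n 1 (\<lambda>_. return_pmf ?c)"
        by (auto simp: is_encoder_def codeword_tuple_def valid_word_def)
      show "mutual_info (msg_obs_dist 1 (\<lambda>_. return_pmf ?c) Z) = 0" for Z
        unfolding msg_obs_dist_def single bind_return_pmf
        by (simp only: pair_return_pmf[symmetric] mutual_info_pair_pmf)
      show "error_prob 2 n 1 (\<lambda>_. return_pmf ?c) (\<lambda>_. 0) Zrw Zro Zwo S J < \<epsilon>" for Zrw Zro Zwo S J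
        using \<epsilon> unfolding error_prob_def single by (simp add: bind_return_pmf measure_pmf_single)
    qed
    then show ?thesis
      using one by (intro exI[of _ 2]) auto
  qed
  then show "\<exists>N. \<forall>n\<ge>N. \<exists>q\<ge>2. \<exists>enc dec. secret_code C z q n (num_messages q n 0) \<epsilon> enc dec"
    by blast
qed simp

theorem theorem6:
  fixes C zrw zro zwo :: nat
  assumes "zrw + zro + zwo \<le> C"
  shows "capacity_ow_secret C (zrw, zro, zwo) =
           (if 2 * zwo + 2 * zrw < C
            then max 0 (real C - (real zwo + real zro + 2 * real zrw))
            else 0)"
proof -
  define A where "A = {R. achievable_ow_secret C (zrw, zro, zwo) R}"
  define k where "k = C - (zrw + zro) - (zrw + zwo)"
  have zero: "0 \<in> A" unfolding A_def using achievable_zero by simp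
  have max_eq: "max 0 (real C - (real zwo + real zro + 2 * real zrw)) = real k"
    unfolding k_def by linarith
  have A_ge: "R \<ge> 0" if "R \<in> A" for R
    using that by (simp add: A_def achievable_ow_secret_def)
  show ?thesis
  proof (cases "2 * zwo + 2 * zrw < C \<and> k > 0")
    case True
    have "Sup A = real k"
    proof (rule cSup_eq_non_empty)
      show "A \<noteq> {}" using zero by auto
      show "R \<le> real k" if "R \<in> A" for R
        using achievable_le[OF assms] that max_eq by (auto simp: A_def)
      fix y assume y: "\<And>R. R \<in> A \<Longrightarrow> R \<le> y"
      have "y \<ge> 0" using y zero by blast
      show "real k \<le> y"
      proof (rule ccontr)
        assume "\<not> real k \<le> y"
        \<comment> \<open>The midpoint is below \<open>k\<close>, hence achievable, yet it exceeds
          the supposed upper bound \<open>y\<close>.\<close>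
        then have "(y + real k) / 2 \<in> A"
          unfolding A_def using True \<open>y \<ge> 0\<close>
          by (intro CollectI achievable_ge[where k = k]) (auto simp: k_def)
        with y \<open>\<not> real k \<le> y\<close> show False by fastforce
      qed
    qed
    then show ?thesis using True max_eq by (simp add: capacity_ow_secret_def A_def)
  next
    case False
    have "R \<le> 0" if "R \<in> A" for R
      using achievable_le[OF assms] achievable_symmetrizable_le[OF assms] that False max_eq
      by (auto simp: A_def not_less)
    then have "A = {0}" using zero A_ge by (auto intro: order_antisym)
    then have "Sup A = 0" by simp
    then show ?thesis using False max_eq by (auto simp: capacity_ow_secret_def A_def)
  qed
qed

end
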